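(* Let $X \sim N(\mu, \sigma^2 I)$, for some fixed $\mu \in \mathbb{R}^n$ and $\sigma^2 > 0$. Let $g : \mathbb{R}^n \to \mathbb{R}$ be p-almost differentiable, with vector of partial derivatives $\nabla g = (\partial g/\partial x_1, \ldots, \partial g/\partial x_n)$. Then, for $i = 1, \ldots, n$, $$\frac{1}{\sigma^2} \mathbb{E}[(X_i - \mu_i) g(X)] = \mathbb{E}\left[ \frac{\partial g}{\partial x_i}(X) \right] + \frac{1}{\sigma} \mathbb{E}\left[ \sum_{\delta \in \mathcal{D}(g(\,\cdot\,, X_{-i}))} \phi\left( \frac{\delta - \mu_i}{\sigma} \right) \big[ g(\delta, X_{-i})_+ - g(\delta, X_{-i})_- \big] \right],$$ provided that $\mathbb{E}\left| \frac{\partial g}{\partial x_i}(X) \right| < \infty$ and $$\mathbb{E}\left| \sum_{\delta \in \mathcal{D}(g(\,\cdot\,, X_{-i}))} \phi\left( \frac{\delta - \mu_i}{\sigma} \right) \big[ g(\delta, X_{-i})_+ - g(\delta, X_{-i})_- \big] \right| < \infty.$$ Here $\phi$ is the standard normal density.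
   Context: A function $h : \mathbb{R} \to \mathbb{R}$ is piecewise absolutely continuous, or p-absolutely continuous, if there exist points $\delta_1 < \delta_2 < \cdots < \delta_m$ such that $h$ is absolutely continuous on each one of the open intervals $(-\infty, \delta_1), (\delta_1, \delta_2), \ldots, (\delta_m, \infty)$. For such $h$, one writes $\mathcal{D}(h) = \{\delta_1, \ldots, \delta_m\}$ for its discontinuity set. For $x \in \mathbb{R}^n$, write $x = (x_i, x_{-i})$, where $x_i \in \mathbb{R}$ is the $i$th component and $x_{-i} \in \mathbb{R}^{n-1}$ collects the other $n-1$ components. For $g : \mathbb{R}^n \to \mathbb{R}$, $g(\,\cdot\,, x_{-i}) : \mathbb{R} \to \mathbb{R}$ denotes $g$ as a function of its $i$th component alone, with all other components fixed at $x_{-i}$. A function $g : \mathbb{R}^n \to \mathbb{R}$ is p-almost differentiable if for every $i = 1, \ldots, n$ and Lebesgue almost every $x_{-i} \in \mathbb{R}^{n-1}$, the function $g(\,\cdot\,, x_{-i}) : \mathbb{R} \to \mathbb{R}$ is p-absolutely continuous. Such a function has partial derivatives almost everywhere, and $\nabla g$ denotes the vector of these partial derivatives. One-sided limits in the $i$th variable are denoted $$g(x_i, x_{-i})_+ = \lim_{t \downarrow x_i} g(t, x_{-i}), \qquad g(x_i, x_{-i})_- = \lim_{t \uparrow x_i} g(t, x_{-i}).$$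
   Formalization: The formal theorem also assumes that g is Borel measurable and that E[(X_i − μ_i)g(X)] is defined (possibly infinite); otherwise the left side can be undefined, e.g. μ=0, σ=1, n=2, i=1, g(x)=x_1+exp(x_2²)·1[|x_1|≤1]. *)

theory Defs
  imports "HOL-Probability.Probability"
begin

text \<open>
  Textbook epsilon-delta absolute continuity on \<^term>\<open>J\<close>. A pair \<^term>\<open>(a, b)\<close> in the finite
  set \<^term>\<open>P\<close> stands for the subinterval with end points \<^term>\<open>a < b\<close>; indexing the family by
  the pairs themselves makes distinct subintervals non-overlapping.
\<close>

definition uniformly_abs_continuous_on :: "real set \<Rightarrow> (real \<Rightarrow> real) \<Rightarrow> bool" where
  "uniformly_abs_continuous_on J h \<longleftrightarrow>
     (\<forall>\<epsilon>>0. \<exists>\<eta>>0. \<forall>P :: (real \<times> real) set.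
        finite P \<longrightarrow> (\<forall>(a, b)\<in>P. a < b \<and> {a..b} \<subseteq> J) \<longrightarrow>
        disjoint_family_on (\<lambda>(a, b). {a<..<b}) P \<longrightarrow>
        (\<Sum>(a, b)\<in>P. b - a) < \<eta> \<longrightarrow> (\<Sum>(a, b)\<in>P. \<bar>h b - h a\<bar>) < \<epsilon>)"

text \<open>
  On a bounded interval this is the textbook notion (take \<^term>\<open>J = I\<close>), so that one-sided limits
  exist at the finite end points. On an unbounded interval it is required on every bounded
  subinterval, as is usual for functions on the real line; otherwise the square function would
  not be absolutely continuous.
\<close>

definition abs_continuous_on :: "real set \<Rightarrow> (real \<Rightarrow> real) \<Rightarrow> bool" where
  "abs_continuous_on I h \<longleftrightarrow>
     (\<forall>J. J \<subseteq> I \<longrightarrow> is_interval J \<longrightarrow> bounded J \<longrightarrow> uniformly_abs_continuous_on J h)"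

definition p_abs_continuous :: "(real \<Rightarrow> real) \<Rightarrow> bool" where
  "p_abs_continuous h \<longleftrightarrow>
     (\<exists>(m::nat) \<delta> :: nat \<Rightarrow> real. 1 \<le> m \<and> strict_mono_on {1..m} \<delta> \<and>
        abs_continuous_on {..<\<delta> 1} h \<and>
        (\<forall>k\<in>{1..<m}. abs_continuous_on {\<delta> k<..<\<delta> (Suc k)} h) \<and>
        abs_continuous_on {\<delta> m<..} h)"

text \<open>
  Finite whenever \<^term>\<open>h\<close> is p-absolutely continuous. An admissible break point at which
  \<^term>\<open>h\<close> happens to be continuous is left out; its jump is zero.
\<close>

definition discontinuity_set :: "(real \<Rightarrow> real) \<Rightarrow> real set" where
  "discontinuity_set h = {t. \<not> isCont h t}"

definition right_limit :: "(real \<Rightarrow> real) \<Rightarrow> real \<Rightarrow> real" where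
  "right_limit h t = Lim (at_right t) h"

definition left_limit :: "(real \<Rightarrow> real) \<Rightarrow> real \<Rightarrow> real" where
  "left_limit h t = Lim (at_left t) h"

text \<open>
  The vector \<open>x\<^sub>-\<^sub>i\<close> is an extensional function on the index set without \<^term>\<open>i\<close>, i.e. a point
  of the product space \<^term>\<open>PiM (UNIV - {i}) (\<lambda>_. lborel)\<close>.
\<close>

definition others :: "'n \<Rightarrow> real ^ 'n \<Rightarrow> 'n \<Rightarrow> real" where
  "others i x = restrict (\<lambda>j. x $ j) (UNIV - {i})"

definition slice :: "(real ^ 'n \<Rightarrow> real) \<Rightarrow> 'n \<Rightarrow> ('n \<Rightarrow> real) \<Rightarrow> real \<Rightarrow> real" where
  "slice g i y t = g (\<chi> j. if j = i then t else y j)"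

definition p_almost_differentiable :: "(real ^ 'n \<Rightarrow> real) \<Rightarrow> bool" where
  "p_almost_differentiable g \<longleftrightarrow>
     (\<forall>i. AE y in (\<Pi>\<^sub>M j\<in>UNIV - {i}. (lborel :: real measure)). p_abs_continuous (slice g i y))"

definition gradient :: "(real ^ 'n \<Rightarrow> real) \<Rightarrow> real ^ 'n \<Rightarrow> real ^ 'n" where
  "gradient g x = (\<chi> i. deriv (slice g i (others i x)) (x $ i))"

definition jump_sum :: "real ^ 'n \<Rightarrow> real \<Rightarrow> (real ^ 'n \<Rightarrow> real) \<Rightarrow> 'n \<Rightarrow> ('n \<Rightarrow> real) \<Rightarrow> real" where
  "jump_sum \<mu> \<sigma> g i y =
     (\<Sum>\<delta>\<in>discontinuity_set (slice g i y).
        std_normal_density ((\<delta> - \<mu> $ i) / \<sigma>) *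
          (right_limit (slice g i y) \<delta> - left_limit (slice g i y) \<delta>))"

text \<open>Lebesgue density of the law \<open>N(\<mu>, \<sigma>\<^sup>2 I)\<close>.\<close>

definition isotropic_normal_density :: "real ^ 'n \<Rightarrow> real \<Rightarrow> real ^ 'n \<Rightarrow> real" where
  "isotropic_normal_density \<mu> \<sigma> x =
     exp (- (norm (x - \<mu>))\<^sup>2 / (2 * \<sigma>\<^sup>2)) / sqrt (2 * pi * \<sigma>\<^sup>2) ^ CARD('n)"

text \<open>
  The expectation of \<^term>\<open>f\<close> is defined, possibly as an infinite value: its positive part or its
  negative part has finite expectation. (\<^const>\<open>ennreal\<close> maps negative reals to zero.)
\<close>

definition has_expectation :: "'a measure \<Rightarrow> ('a \<Rightarrow> real) \<Rightarrow> bool" where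
  "has_expectation M f \<longleftrightarrow> f \<in> borel_measurable M \<and>
     ((\<integral>\<^sup>+\<omega>. ennreal (f \<omega>) \<partial>M) < \<infinity> \<or> (\<integral>\<^sup>+\<omega>. ennreal (- f \<omega>) \<partial>M) < \<infinity>)"

end

theory Submission
  imports Defs
begin

text \<open>
  On a line parallel to the \<open>i\<close>-th axis the identity is integration by parts. The normal density
  \<open>w\<close> with mean \<open>m\<close> and standard deviation \<open>\<sigma>\<close> satisfies \<open>w'(t) = - (t - m) / \<sigma>\<^sup>2 * w(t)\<close>, so the
  expectation of \<open>(t - m) / \<sigma>\<^sup>2 * h(t)\<close> is minus the integral of \<open>h * w'\<close>. A piecewise absolutely
  continuous \<open>h\<close> is the sum of a continuous function, which is the integral of \<open>h'\<close>, and of a step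
  function carrying the jumps. The first summand contributes the expectation of \<open>h'\<close>, and each jump
  contributes \<open>w(\<delta>)\<close> times its height, because the integral of \<open>(t - m) / \<sigma>\<^sup>2 * w(t)\<close> over
  \<open>t > \<delta>\<close> is \<open>w(\<delta>)\<close>. This is \<open>Stein_p_abs_continuous\<close>. Its continuous half,
  \<open>Stein_continuous\<close>, exchanges the two integrals in \<open>k(t) - k(m) = \<integral> h'\<close>; the kernel that appears
  is nonnegative, so integrability of \<open>h' * w\<close> is all that Fubini's theorem asks for, and
  integrability of \<open>(t - m) * h(t) * w(t)\<close> comes out as a by-product.
  
  The one-dimensional identity rests on two classical facts about an absolutely continuous \<open>h\<close>,
  both proved here from the definition. It is differentiable almost everywhere: the points at which
  the slopes of short intervals are unbounded, or oscillate between two rationals \<open>p < q\<close>, form null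
  sets by the Vitali covering theorem (\<open>negligible_infinite_slope\<close>, \<open>negligible_two_slopes\<close>). And it
  is the integral of its derivative, in the Henstock-Kurzweil sense
  (\<open>fundamental_theorem_of_calculus_abs_continuous\<close>): a gauge can confine the tags in the exceptional
  null set to an open set so small that absolute continuity makes their contribution negligible.
  
  To pass to \<open>n\<close> dimensions, the normal law is written as the image of the product of the law of the
  other coordinates with a one-dimensional normal law (\<open>isotropic_normal_eq_distr\<close>), and the
  identity on the slices is integrated. Two points need care. First, neither the gradient nor the sum
  of the jumps is given as a Borel function. The partial derivative is replaced by a limit of
  difference quotients along \<open>1 / n\<close>, with which it agrees wherever the slice is differentiable, and
  that set is recognised through rational increments. The sum of the jumps is replaced by the
  difference of the two other terms of the identity. Secondly, the slices give only the iterated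
  integral of \<open>(x\<^sub>i - \<mu>\<^sub>i) * g(x)\<close>. Since that function has an expectation, possibly infinite, one of its
  two parts is integrable; then so is the other, as the iterated integral is finite
  (\<open>integrable_if_iterated_integrals\<close>).
\<close>

section \<open>Finite families of non-overlapping intervals\<close>

definition next_point :: "real set \<Rightarrow> real \<Rightarrow> real" where
  "next_point Z z = Min {z' \<in> Z. z < z'}"

lemma next_point:
  assumes "finite Z" "v \<in> Z" "z < v"
  shows "next_point Z z \<in> Z" "z < next_point Z z" "next_point Z z \<le> v"
    and "\<And>y. y \<in> Z \<Longrightarrow> z < y \<Longrightarrow> next_point Z z \<le> y"
proof -
  have fin: "finite {z' \<in> Z. z < z'}" and ne: "{z' \<in> Z. z < z'} \<noteq> {}"
    using assms by auto
  show "next_point Z z \<in> Z" "z < next_point Z z"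
    using Min_in[OF fin ne] by (auto simp: next_point_def)
  show *: "\<And>y. y \<in> Z \<Longrightarrow> z < y \<Longrightarrow> next_point Z z \<le> y"
    unfolding next_point_def using fin by (auto intro: Min_le)
  show "next_point Z z \<le> v" using * assms by auto
qed

lemma sum_next_point_telescope:
  fixes f :: "real \<Rightarrow> real"
  assumes "finite Z" "u \<in> Z" "v \<in> Z" "u \<le> v"
  shows "(\<Sum>z\<in>Z \<inter> {u..<v}. f (next_point Z z) - f z) = f v - f u"
  using assms(2,4)
proof (induction "card (Z \<inter> {u..<v})" arbitrary: u rule: less_induct)
  case less
  show ?case
  proof (cases "u = v")
    case False
    with less.prems have "u < v" by simp
    note n = next_point[OF \<open>finite Z\<close> \<open>v \<in> Z\<close> \<open>u < v\<close>]
    have split: "Z \<inter> {u..<v} = insert u (Z \<inter> {next_point Z u..<v})"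
      using n less.prems \<open>u < v\<close> by force
    have notin: "u \<notin> Z \<inter> {next_point Z u..<v}" using n(2) by auto
    have "card (Z \<inter> {next_point Z u..<v}) < card (Z \<inter> {u..<v})"
      unfolding split using notin \<open>finite Z\<close> by simp
    from less.hyps[OF this n(1) n(3)]
    show ?thesis unfolding split using notin \<open>finite Z\<close> by (subst sum.insert) auto
  qed auto
qed

text \<open>
  The index sets of the definition of absolute continuity, with the requirement that the intervals
  lie in a given set split off, so that families can be refined and complemented.
\<close>

definition interval_family :: "(real \<times> real) set \<Rightarrow> bool" where
  "interval_family P \<longleftrightarrow> finite P \<and> (\<forall>p\<in>P. fst p < snd p) \<and>
     disjoint_family_on (\<lambda>p. {fst p<..<snd p}) P"

lemma interval_family_half_open:
  assumes "interval_family P"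
  shows "disjoint_family_on (\<lambda>p. {fst p..<snd p}) P"
proof -
  have False if "p \<in> P" "q \<in> P" "p \<noteq> q" "x \<in> {fst p..<snd p}" "x \<in> {fst q..<snd q}" for p q x
  proof -
    have "max (fst p) (fst q) < min (snd p) (snd q)" using that by auto
    then obtain y where "max (fst p) (fst q) < y" "y < min (snd p) (snd q)" using dense by blast
    then have "y \<in> {fst p<..<snd p} \<inter> {fst q<..<snd q}" by auto
    with assms that show False unfolding interval_family_def disjoint_family_on_def by blast
  qed
  then show ?thesis unfolding disjoint_family_on_def by blast
qed

text \<open>
  The family \<open>T\<close> consists of the gaps that \<open>R\<close> leaves in \<open>P\<close>. Listing all end points and cutting at
  each of them yields cells between consecutive points; the cells in \<open>P\<close> but not in \<open>R\<close> make up \<open>T\<close>.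
  For \<open>f\<close> the identity, the sum formula compares lengths; for an absolutely continuous \<open>f\<close>, it says
  that increments over \<open>P\<close> and over \<open>R\<close> are close as soon as the gaps are short.
\<close>

lemma interval_family_gaps:
  assumes P: "interval_family P" and R: "interval_family R"
    and sub: "\<And>r. r \<in> R \<Longrightarrow> \<exists>p\<in>P. fst p \<le> fst r \<and> snd r \<le> snd p"
  obtains T where "interval_family T"
    "\<And>t. t \<in> T \<Longrightarrow> \<exists>p\<in>P. fst p \<le> fst t \<and> snd t \<le> snd p"
    "\<And>f :: real \<Rightarrow> real. (\<Sum>p\<in>P. f (snd p) - f (fst p)) =
        (\<Sum>p\<in>R. f (snd p) - f (fst p)) + (\<Sum>p\<in>T. f (snd p) - f (fst p))"
proof -
  define Z where "Z = fst ` P \<union> snd ` P \<union> fst ` R \<union> snd ` R"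
  define N where "N = next_point Z"
  define cells where "cells Q = (\<Union>q\<in>Q. Z \<inter> {fst q..<snd q})" for Q :: "(real \<times> real) set"
  define T where "T = (\<lambda>z. (z, N z)) ` (cells P - cells R)"
  have fP: "finite P" "finite R" using P R by (auto simp: interval_family_def)
  have fZ: "finite Z" using fP by (auto simp: Z_def)
  have PRZ: "fst ` P \<subseteq> Z" "snd ` P \<subseteq> Z" "fst ` R \<subseteq> Z" "snd ` R \<subseteq> Z"
    by (auto simp: Z_def)
  have fc: "finite (cells Q)" for Q
    by (rule finite_subset[OF _ fZ]) (auto simp: cells_def)
  have inj: "inj_on (\<lambda>z. (z, N z)) A" for A by (auto simp: inj_on_def)
  have cells_sum: "(\<Sum>z\<in>cells Q. f (N z) - f z) = (\<Sum>q\<in>Q. f (snd q) - f (fst q))"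
    if Q: "interval_family Q" and QZ: "fst ` Q \<subseteq> Z" "snd ` Q \<subseteq> Z" for Q and f :: "real \<Rightarrow> real"
  proof -
    have "(\<Sum>z\<in>cells Q. f (N z) - f z) = (\<Sum>q\<in>Q. \<Sum>z\<in>Z \<inter> {fst q..<snd q}. f (N z) - f z)"
      unfolding cells_def
    proof (rule sum.UNION_disjoint)
      show "finite Q" using Q by (auto simp: interval_family_def)
      show "\<forall>q\<in>Q. finite (Z \<inter> {fst q..<snd q})" using fZ by auto
      show "\<forall>i\<in>Q. \<forall>j\<in>Q. i \<noteq> j \<longrightarrow> Z \<inter> {fst i..<snd i} \<inter> (Z \<inter> {fst j..<snd j}) = {}"
        using interval_family_half_open[OF Q] unfolding disjoint_family_on_def by blast
    qed
    also have "\<dots> = (\<Sum>q\<in>Q. f (snd q) - f (fst q))"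
    proof (rule sum.cong[OF refl])
      fix q assume "q \<in> Q"
      then have "fst q \<in> Z" "snd q \<in> Z" "fst q \<le> snd q"
        using Q QZ by (auto simp: interval_family_def image_subset_iff less_imp_le)
      then show "(\<Sum>z\<in>Z \<inter> {fst q..<snd q}. f (N z) - f z) = f (snd q) - f (fst q)"
        unfolding N_def using sum_next_point_telescope[OF fZ] by blast
    qed
    finally show ?thesis .
  qed
  have RP: "cells R \<subseteq> cells P"
  proof
    fix z assume "z \<in> cells R"
    then obtain r where r: "r \<in> R" "z \<in> Z" "fst r \<le> z" "z < snd r" by (auto simp: cells_def)
    from sub[OF r(1)] obtain p where "p \<in> P" "fst p \<le> fst r" "snd r \<le> snd p" by blast
    with r show "z \<in> cells P" unfolding cells_def by (auto intro!: bexI[of _ p])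
  qed
  have cellN: "\<exists>p\<in>P. fst p \<le> z \<and> N z \<le> snd p \<and> z < N z \<and> (\<forall>y\<in>Z. z < y \<longrightarrow> N z \<le> y)"
    if z: "z \<in> cells P" for z
  proof -
    obtain p where p: "p \<in> P" "z \<in> Z" "fst p \<le> z" "z < snd p" using z by (auto simp: cells_def)
    then have "snd p \<in> Z" by (auto simp: Z_def)
    from next_point[OF fZ this p(4)] p show ?thesis unfolding N_def by blast
  qed
  show ?thesis
  proof (rule that[of T])
    show "\<exists>p\<in>P. fst p \<le> fst t \<and> snd t \<le> snd p" if "t \<in> T" for t
      using that cellN by (fastforce simp: T_def)
    have disj: "disjoint_family_on (\<lambda>p. {fst p<..<snd p}) T"
    proof -
      have "y \<le> x" if "x \<in> cells P" "y \<in> cells P" "w \<in> {x<..<N x}" "w \<in> {y<..<N y}" for x y w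
      proof (rule ccontr)
        assume "\<not> y \<le> x"
        moreover have "y \<in> Z" using that by (auto simp: cells_def)
        ultimately have "N x \<le> y" using cellN[OF that(1)] by auto
        then show False using that by auto
      qed
      then have "x = y" if "x \<in> cells P" "y \<in> cells P" "w \<in> {x<..<N x}" "w \<in> {y<..<N y}" for x y w
        using that by (meson order_antisym)
      then show ?thesis unfolding disjoint_family_on_def T_def by fastforce
    qed
    show "interval_family T"
      unfolding interval_family_def using fc disj cellN by (auto simp: T_def)
    show "(\<Sum>p\<in>P. f (snd p) - f (fst p)) =
        (\<Sum>p\<in>R. f (snd p) - f (fst p)) + (\<Sum>p\<in>T. f (snd p) - f (fst p))" for f :: "real \<Rightarrow> real"
    proof -
      have "(\<Sum>p\<in>T. f (snd p) - f (fst p)) = (\<Sum>z\<in>cells P - cells R. f (N z) - f z)"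
        unfolding T_def by (subst sum.reindex[OF inj]) simp
      also have "\<dots> = (\<Sum>z\<in>cells P. f (N z) - f z) - (\<Sum>z\<in>cells R. f (N z) - f z)"
        by (rule sum_diff[OF fc RP])
      finally show ?thesis
        using cells_sum[OF P, of f] cells_sum[OF R, of f] PRZ by simp
    qed
  qed
qed

text \<open>
  Sums of lengths are compared through Lebesgue measure, which spares any combinatorics of end points.
\<close>

lemma interval_family_length_le:
  assumes P: "interval_family P" and U: "U \<in> lmeasurable"
    and sub: "\<And>p. p \<in> P \<Longrightarrow> {fst p<..<snd p} \<subseteq> U"
  shows "(\<Sum>p\<in>P. snd p - fst p) \<le> measure lebesgue U"
proof -
  define I where "I p = {fst p<..<snd p::real}" for p
  have lmI: "I p \<in> lmeasurable" for p
    unfolding I_def by (metis lmeasurable_box box_real(1))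
  have fin: "finite P" and lt: "\<And>p. p \<in> P \<Longrightarrow> fst p < snd p" and disj: "disjoint_family_on I P"
    using P by (auto simp: interval_family_def I_def[abs_def])
  have "(\<Sum>p\<in>P. snd p - fst p) = (\<Sum>p\<in>P. measure lebesgue (I p))"
    by (rule sum.cong[OF refl]) (simp add: I_def less_imp_le[OF lt])
  also have "\<dots> = measure lebesgue (\<Union>p\<in>P. I p)"
  proof (rule measure_finite_Union[symmetric, OF fin _ disj])
    show "I ` P \<subseteq> sets lebesgue" using lmI by blast
    show "emeasure lebesgue (I p) \<noteq> \<infinity>" for p using fmeasurableD2[OF lmI] by simp
  qed
  also have "\<dots> \<le> measure lebesgue U"
  proof (rule measure_mono_fmeasurable[OF _ _ U])
    show "\<Union> (I ` P) \<subseteq> U" using sub by (auto simp: I_def)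
    show "\<Union> (I ` P) \<in> sets lebesgue" using fin lmI by (intro sets.finite_UN) auto
  qed
  finally show ?thesis .
qed

section \<open>Vitali coverings by intervals\<close>

text \<open>
  The covering theorem for closed balls gives countably many disjoint intervals that miss only a null
  set. All but finitely many of them have small total length and can be moved into the remainder \<open>W\<close>,
  and finite families are what absolute continuity can be applied to.
\<close>

lemma Vitali_covering_intervals:
  fixes S U :: "real set"
  assumes U: "open U" "bounded U" "S \<subseteq> U" and "e > 0"
    and cover: "\<And>x d. x \<in> S \<Longrightarrow> d > 0 \<Longrightarrow>
      \<exists>u v. u < v \<and> u \<le> x \<and> x \<le> v \<and> v - u < d \<and> Q u v"
  obtains P W where "interval_family P"
    "\<And>p. p \<in> P \<Longrightarrow> {fst p..snd p} \<subseteq> U \<and> Q (fst p) (snd p)"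
    "W \<in> lmeasurable" "measure lebesgue W < e" "S \<subseteq> (\<Union>p\<in>P. {fst p..snd p}) \<union> W"
    "(\<Sum>p\<in>P. snd p - fst p) \<le> measure lebesgue U"
proof -
  define K where "K = {p. fst p < snd p \<and> {fst p..snd p} \<subseteq> U \<and> Q (fst p) (snd p)}"
  define I where "I p = {fst p..snd p::real}" for p
  have cb: "cball ((fst p + snd p) / 2) ((snd p - fst p) / 2) = I p" for p :: "real \<times> real"
    unfolding cball_eq_atLeastAtMost I_def by (simp add: field_simps)
  have "\<exists>p. p \<in> K \<and> x \<in> I p \<and> (snd p - fst p) / 2 < d" if x: "x \<in> S" and d: "d > 0" for x d
  proof -
    obtain r where r: "r > 0" "ball x r \<subseteq> U" using U x by (meson open_contains_ball subsetD)
    obtain u v where uv: "u < v" "u \<le> x" "x \<le> v" "v - u < min r d" "Q u v"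
      using cover[OF x, of "min r d"] r d by auto
    have "{u..v} \<subseteq> ball x r" using uv by (auto simp: dist_real_def)
    then have "(u, v) \<in> K" using uv r by (auto simp: K_def)
    moreover have "x \<in> I (u, v)" "(v - u) / 2 < d" using uv by (auto simp: I_def)
    ultimately show ?thesis by (intro exI[of _ "(u, v)"]) auto
  qed
  note K_cover = this
  obtain C where "countable C" "C \<subseteq> K"
    "pairwise (\<lambda>p q. disjnt (cball ((fst p + snd p) / 2) ((snd p - fst p) / 2))
      (cball ((fst q + snd q) / 2) ((snd q - fst q) / 2))) C"
    "negligible (S - (\<Union>p\<in>C. cball ((fst p + snd p) / 2) ((snd p - fst p) / 2)))"
  proof (rule Vitali_covering_theorem_cballs)
    show "0 < (snd p - fst p) / 2" if "p \<in> K" for p using that by (simp add: K_def)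
    show "\<exists>p. p \<in> K \<and> x \<in> cball ((fst p + snd p) / 2) ((snd p - fst p) / 2) \<and> (snd p - fst p) / 2 < d"
      if "x \<in> S" "0 < d" for x d
      unfolding cb using that by (rule K_cover)
  qed
  then have C: "countable C" "C \<subseteq> K" "pairwise (\<lambda>i j. disjnt (I i) (I j)) C"
    "negligible (S - (\<Union>i\<in>C. I i))"
    unfolding cb by simp_all
  have lmU: "U \<in> lmeasurable" using U by (simp add: lmeasurable_open)
  have IU: "I p \<subseteq> U" if "p \<in> C" for p using that C by (auto simp: K_def I_def)
  have lmI: "I p \<in> lmeasurable" for p
    unfolding I_def by (metis lmeasurable_cbox cbox_interval)
  have lmC: "(\<Union>p\<in>C. I p) \<in> lmeasurable"
  proof (rule fmeasurableI2[OF lmU])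
    show "(\<Union>p\<in>C. I p) \<subseteq> U" using IU by blast
    show "(\<Union>p\<in>C. I p) \<in> sets lebesgue"
      using C(1) lmI by (intro sets.countable_UN'') blast+
  qed
  obtain D where D: "D \<subseteq> I ` C" "finite D"
      "measure lebesgue (\<Union>(I ` C)) - e < measure lebesgue (\<Union>D)"
  proof (rule measure_countable_Union_approachable[of "I ` C" e "measure lebesgue U"])
    show "countable (I ` C)" using C(1) by (rule countable_image)
    show "d \<in> lmeasurable" if "d \<in> I ` C" for d using that lmI by blast
    show "measure lebesgue (\<Union>D') \<le> measure lebesgue U" if D': "D' \<subseteq> I ` C" "finite D'" for D'
    proof (rule measure_mono_fmeasurable[OF _ _ lmU])
      show "\<Union>D' \<subseteq> U" using D' IU by blast
      have "\<Union>D' \<in> lmeasurable" using D' lmI by (intro fmeasurable.finite_Union) auto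
      then show "\<Union>D' \<in> sets lebesgue" by (rule fmeasurableD)
    qed
  qed (use \<open>e > 0\<close> in simp_all)
  then obtain P where P: "P \<subseteq> C" "finite P" "D = I ` P"
    by (meson finite_subset_image)
  define W where "W = (S - (\<Union>i\<in>C. I i)) \<union> ((\<Union>i\<in>C. I i) - (\<Union>i\<in>P. I i))"
  have lmP: "(\<Union>p\<in>P. I p) \<in> lmeasurable" using P lmI by (intro fmeasurable.finite_UN) auto
  have lmD: "(\<Union>i\<in>C. I i) - (\<Union>i\<in>P. I i) \<in> lmeasurable" using lmC lmP by (rule fmeasurable.Diff)
  have lmN: "S - (\<Union>i\<in>C. I i) \<in> lmeasurable" using C(4) by (rule negligible_imp_measurable)
  have pw: "pairwise (\<lambda>i j. disjnt (I i) (I j)) P" using C(3) P(1) by (rule pairwise_subset)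
  have lt: "fst p < snd p" if "p \<in> P" for p using that P C by (auto simp: K_def)
  show ?thesis
  proof (rule that[of P W])
    have "disjoint_family_on (\<lambda>p. {fst p<..<snd p}) P"
      unfolding disjoint_family_on_def
    proof (intro ballI impI)
      fix p q assume "p \<in> P" "q \<in> P" "p \<noteq> q"
      then have "disjnt (I p) (I q)" using pw by (auto simp: pairwise_def)
      then show "{fst p<..<snd p} \<inter> {fst q<..<snd q} = {}" by (fastforce simp: disjnt_def I_def)
    qed
    then show fam: "interval_family P" unfolding interval_family_def using P lt by auto
    show "{fst p..snd p} \<subseteq> U \<and> Q (fst p) (snd p)" if "p \<in> P" for p
      using that P C by (auto simp: K_def)
    show "W \<in> lmeasurable" unfolding W_def by (rule fmeasurable.Un[OF lmN lmD])
    have "measure lebesgue W \<le> measure lebesgue (S - (\<Union>i\<in>C. I i)) +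
        measure lebesgue ((\<Union>i\<in>C. I i) - (\<Union>i\<in>P. I i))"
      unfolding W_def using lmN lmD by (intro measure_Un_le) auto
    also have "measure lebesgue (S - (\<Union>i\<in>C. I i)) = 0"
      using C(4) by (rule negligible_imp_measure0)
    also have "measure lebesgue ((\<Union>i\<in>C. I i) - (\<Union>i\<in>P. I i)) =
        measure lebesgue (\<Union>i\<in>C. I i) - measure lebesgue (\<Union>i\<in>P. I i)"
      using lmC lmP P(1) by (intro measurable_measure_Diff) auto
    finally show "measure lebesgue W < e" using D P by simp
    show "S \<subseteq> (\<Union>p\<in>P. {fst p..snd p}) \<union> W" by (auto simp: W_def I_def)
    show "(\<Sum>p\<in>P. snd p - fst p) \<le> measure lebesgue U"
    proof (rule interval_family_length_le[OF fam lmU])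
      show "{fst p<..<snd p} \<subseteq> U" if "p \<in> P" for p
        using that P(1) IU[of p] by (fastforce simp: I_def)
    qed
  qed
qed

lemma lmeasurable_subset_open:
  fixes S :: "'a::euclidean_space set"
  assumes S: "S \<in> lmeasurable" and "e > 0"
  obtains V where "open V" "S \<subseteq> V" "V \<in> lmeasurable" "measure lebesgue V < measure lebesgue S + e"
proof -
  obtain V where V: "open V" "S \<subseteq> V" "V - S \<in> lmeasurable" "emeasure lebesgue (V - S) < ennreal e"
    using sets_lebesgue_outer_open[OF fmeasurableD[OF S] \<open>e > 0\<close>] by metis
  have eq: "V = S \<union> (V - S)" using V by blast
  have "V \<in> lmeasurable" by (subst eq) (rule fmeasurable.Un[OF S V(3)])
  moreover have "measure lebesgue V \<le> measure lebesgue S + measure lebesgue (V - S)"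
    by (subst eq) (rule measure_Un_le[OF fmeasurableD[OF S] fmeasurableD[OF V(3)]])
  moreover have "measure lebesgue (V - S) < e"
    using V(4) \<open>e > 0\<close> by (simp add: emeasure_eq_measure2[OF V(3)] ennreal_less_iff)
  ultimately show ?thesis using that V by auto
qed

text \<open>
  The sets of bad points below are not known to be measurable; a measurable hull stands in for their
  outer measure.
\<close>

lemma lmeasurable_hull:
  fixes S :: "real set"
  assumes "bounded S"
  obtains H where "H \<in> lmeasurable" "S \<subseteq> H"
    "\<And>T. T \<in> lmeasurable \<Longrightarrow> S \<subseteq> T \<Longrightarrow> measure lebesgue H \<le> measure lebesgue T"
proof -
  obtain H where H: "H \<in> sets lebesgue" "S \<subseteq> H" "outer_measure_of lebesgue S = emeasure lebesgue H"
    using outer_measure_of_attain[of S lebesgue] by auto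
  have min: "emeasure lebesgue H \<le> emeasure lebesgue T" if "T \<in> lmeasurable" "S \<subseteq> T" for T
    unfolding H(3)[symmetric] outer_measure_of_def using that by (auto intro: INF_lower)
  obtain a b where "S \<subseteq> cbox a b" using assms bounded_subset_cbox_symmetric by metis
  from min[OF lmeasurable_cbox this] have fin: "emeasure lebesgue H < \<infinity>"
    using fmeasurableD2[OF lmeasurable_cbox[of a b]] by (auto simp: top.not_eq_extremum intro: le_less_trans)
  then have lm: "H \<in> lmeasurable" using H by (auto intro: fmeasurableI)
  show ?thesis
  proof (rule that[OF lm H(2)])
    fix T assume T: "T \<in> lmeasurable" "S \<subseteq> T"
    show "measure lebesgue H \<le> measure lebesgue T"
      unfolding measure_def using min[OF T] fmeasurableD2[OF T(1)]
      by (intro enn2real_mono) (auto simp: top.not_eq_extremum)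
  qed
qed

lemma measure_covering_intervals:
  fixes W :: "real set"
  assumes P: "interval_family P" and W: "W \<in> lmeasurable"
  shows "(\<Union>p\<in>P. {fst p..snd p}) \<union> W \<in> lmeasurable"
    "measure lebesgue ((\<Union>p\<in>P. {fst p..snd p}) \<union> W) \<le>
      (\<Sum>p\<in>P. snd p - fst p) + measure lebesgue W"
proof -
  have fin: "finite P" and lt: "\<And>p. p \<in> P \<Longrightarrow> fst p < snd p"
    using P by (auto simp: interval_family_def)
  have I: "{fst p..snd p} \<in> lmeasurable" for p :: "real \<times> real"
    by (metis lmeasurable_cbox cbox_interval)
  have U: "(\<Union>p\<in>P. {fst p..snd p}) \<in> lmeasurable" using fin I by (intro fmeasurable.finite_UN) auto
  show "(\<Union>p\<in>P. {fst p..snd p}) \<union> W \<in> lmeasurable" using U W by (rule fmeasurable.Un)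
  have "measure lebesgue (\<Union>p\<in>P. {fst p..snd p}) \<le> (\<Sum>p\<in>P. measure lebesgue {fst p..snd p})"
    using fin I by (intro measure_UNION_le) auto
  also have "\<dots> = (\<Sum>p\<in>P. snd p - fst p)"
    by (rule sum.cong[OF refl]) (simp add: less_imp_le[OF lt])
  finally show "measure lebesgue ((\<Union>p\<in>P. {fst p..snd p}) \<union> W) \<le>
      (\<Sum>p\<in>P. snd p - fst p) + measure lebesgue W"
    using measure_Un_le[OF fmeasurableD[OF U] fmeasurableD[OF W]] by linarith
qed

section \<open>Absolutely continuous functions are differentiable almost everywhere\<close>

lemma uniformly_abs_continuous_onD:
  assumes "uniformly_abs_continuous_on J h" "\<epsilon> > 0"
  obtains \<eta> where "\<eta> > 0"
    "\<And>P. interval_family P \<Longrightarrow> (\<And>p. p \<in> P \<Longrightarrow> {fst p..snd p} \<subseteq> J) \<Longrightarrow>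
      (\<Sum>p\<in>P. snd p - fst p) < \<eta> \<Longrightarrow> (\<Sum>p\<in>P. \<bar>h (snd p) - h (fst p)\<bar>) < \<epsilon>"
proof -
  from assms obtain \<eta> where \<eta>: "\<eta> > 0" and *: "\<forall>P. finite P \<longrightarrow> (\<forall>(a, b)\<in>P. a < b \<and> {a..b} \<subseteq> J) \<longrightarrow>
        disjoint_family_on (\<lambda>(a, b). {a<..<b}) P \<longrightarrow>
        (\<Sum>(a, b)\<in>P. b - a) < \<eta> \<longrightarrow> (\<Sum>(a, b)\<in>P. \<bar>h b - h a\<bar>) < \<epsilon>"
    unfolding uniformly_abs_continuous_on_def by blast
  show ?thesis
  proof (rule that[OF \<eta>])
    fix P assume P: "interval_family P" "\<And>p. p \<in> P \<Longrightarrow> {fst p..snd p} \<subseteq> J"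
      "(\<Sum>p\<in>P. snd p - fst p) < \<eta>"
    have "\<forall>(a, b)\<in>P. a < b \<and> {a..b} \<subseteq> J"
      using P(1,2) unfolding interval_family_def split_def by blast
    then show "(\<Sum>p\<in>P. \<bar>h (snd p) - h (fst p)\<bar>) < \<epsilon>"
      using *[rule_format, of P] P(1,3) unfolding interval_family_def split_def by blast
  qed
qed

text \<open>
  Let \<open>s\<close> be the outer measure of \<open>S\<close>. Cover \<open>S\<close>, inside an open set of measure at most \<open>s + e\<close>, by
  disjoint intervals of slope at most \<open>p\<close>, and then cover the part of \<open>S\<close> inside those intervals by
  disjoint intervals of slope at least \<open>q\<close>. Both families have total length \<open>s\<close> up to a multiple of
  \<open>e\<close>, so the gaps between them are short and, by absolute continuity, the total increments of \<open>h\<close>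
  over the two families nearly agree. They are at most \<open>p * s\<close> and at least \<open>q * s\<close> up to small errors,
  which forces \<open>s = 0\<close>.
\<close>

lemma negligible_two_slopes:
  fixes S J :: "real set"
  assumes ac: "uniformly_abs_continuous_on J h" and J: "open J" "bounded J" "S \<subseteq> J" and "p < q"
    and low: "\<And>x d. x \<in> S \<Longrightarrow> d > 0 \<Longrightarrow>
      \<exists>u v. u < v \<and> u \<le> x \<and> x \<le> v \<and> v - u < d \<and> h v - h u \<le> p * (v - u)"
    and high: "\<And>x d. x \<in> S \<Longrightarrow> d > 0 \<Longrightarrow>
      \<exists>u v. u < v \<and> u \<le> x \<and> x \<le> v \<and> v - u < d \<and> q * (v - u) \<le> h v - h u"
  shows "negligible S"
proof -
  have "bounded S" using J bounded_subset by blast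
  then obtain H where H: "H \<in> lmeasurable" "S \<subseteq> H"
    and minH: "\<And>T. T \<in> lmeasurable \<Longrightarrow> S \<subseteq> T \<Longrightarrow> measure lebesgue H \<le> measure lebesgue T"
    using lmeasurable_hull by metis
  define s where "s = measure lebesgue H"
  define A where "A = 1 + 2 * (q - p) + 3 * \<bar>p\<bar>"
  have "A > 0" using \<open>p < q\<close> by (simp add: A_def)
  have main: "(q - p) * s \<le> A * \<epsilon>" if "\<epsilon> > 0" for \<epsilon>
  proof -
    obtain \<eta> where \<eta>: "\<eta> > 0"
      "\<And>P. interval_family P \<Longrightarrow> (\<And>p. p \<in> P \<Longrightarrow> {fst p..snd p} \<subseteq> J) \<Longrightarrow>
        (\<Sum>p\<in>P. snd p - fst p) < \<eta> \<Longrightarrow> (\<Sum>p\<in>P. \<bar>h (snd p) - h (fst p)\<bar>) < \<epsilon>"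
      using uniformly_abs_continuous_onD[OF ac \<open>\<epsilon> > 0\<close>] by blast
    \<comment> \<open>The gaps will have total length below \<open>3 * e\<close>.\<close>
    define e where "e = min \<epsilon> (\<eta> / 4)"
    have e: "e > 0" "e \<le> \<epsilon>" "3 * e < \<eta>" using \<eta>(1) \<open>\<epsilon> > 0\<close> by (auto simp: e_def)
    obtain V where V: "open V" "H \<subseteq> V" "V \<in> lmeasurable" "measure lebesgue V < s + e"
      using lmeasurable_subset_open[OF H(1) \<open>e > 0\<close>] unfolding s_def by blast
    define U where "U = V \<inter> J"
    have U: "open U" "bounded U" "S \<subseteq> U" "U \<subseteq> J"
      using V J H by (auto simp: U_def intro: bounded_subset)
    have mU: "measure lebesgue U < s + e"
    proof -
      have "measure lebesgue U \<le> measure lebesgue V"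
        using U V by (intro measure_mono_fmeasurable) (auto simp: U_def)
      then show ?thesis using V by simp
    qed
    obtain P W where P: "interval_family P"
      "\<And>r. r \<in> P \<Longrightarrow> {fst r..snd r} \<subseteq> U \<and> h (snd r) - h (fst r) \<le> p * (snd r - fst r)"
      and W: "W \<in> lmeasurable" "measure lebesgue W < e" "S \<subseteq> (\<Union>r\<in>P. {fst r..snd r}) \<union> W"
      and PU: "(\<Sum>r\<in>P. snd r - fst r) \<le> measure lebesgue U"
      using Vitali_covering_intervals[where Q = "\<lambda>u v. h v - h u \<le> p * (v - u)", OF U(1-3) e(1) low]
      by blast
    define U' where "U' = (\<Union>r\<in>P. {fst r<..<snd r})"
    have U': "open U'" "U' \<subseteq> U" using P(2) by (force simp: U'_def)+
    then have "bounded U'" using U bounded_subset by blast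
    have low': "\<And>x d. x \<in> S \<inter> U' \<Longrightarrow> d > 0 \<Longrightarrow>
      \<exists>u v. u < v \<and> u \<le> x \<and> x \<le> v \<and> v - u < d \<and> q * (v - u) \<le> h v - h u"
      using high by blast
    have "\<exists>R W'. interval_family R \<and>
        (\<forall>r\<in>R. {fst r..snd r} \<subseteq> U' \<and> q * (snd r - fst r) \<le> h (snd r) - h (fst r)) \<and>
        W' \<in> lmeasurable \<and> measure lebesgue W' < e \<and> S \<inter> U' \<subseteq> (\<Union>r\<in>R. {fst r..snd r}) \<union> W'"
      by (rule Vitali_covering_intervals[where Q = "\<lambda>u v. q * (v - u) \<le> h v - h u",
          OF U'(1) \<open>bounded U'\<close> Int_lower2 e(1) low']) blast+
    then obtain R W' where R: "interval_family R"
      "\<And>r. r \<in> R \<Longrightarrow> {fst r..snd r} \<subseteq> U' \<and> q * (snd r - fst r) \<le> h (snd r) - h (fst r)"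
      and W': "W' \<in> lmeasurable" "measure lebesgue W' < e"
        "S \<inter> U' \<subseteq> (\<Union>r\<in>R. {fst r..snd r}) \<union> W'"
      by blast
    have finP: "finite P" and ltP: "\<And>r. r \<in> P \<Longrightarrow> fst r < snd r"
      using P(1) by (auto simp: interval_family_def)
    have finR: "finite R" and ltR: "\<And>r. r \<in> R \<Longrightarrow> fst r < snd r"
      using R(1) by (auto simp: interval_family_def)
    \<comment> \<open>Intervals of \<open>P\<close> are closed but \<open>U'\<close> is open: the end points form a separate null set.\<close>
    define E where "E = fst ` P \<union> snd ` P"
    have E: "negligible E" unfolding E_def using finP by (intro negligible_finite) auto
    have "S \<subseteq> (\<Union>r\<in>R. {fst r..snd r}) \<union> (W \<union> W' \<union> E)"
    proof
      fix x assume x: "x \<in> S"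
      show "x \<in> (\<Union>r\<in>R. {fst r..snd r}) \<union> (W \<union> W' \<union> E)"
      proof (cases "x \<in> W \<or> x \<in> U'")
        case False
        then obtain r where r: "r \<in> P" "x \<in> {fst r..snd r}" using x W(3) by blast
        have "\<not> (fst r < x \<and> x < snd r)" using False r by (auto simp: U'_def)
        then have "x = fst r \<or> x = snd r" using r by auto
        then show ?thesis using r by (auto simp: E_def)
      qed (use x W'(3) in blast)
    qed
    moreover have WE: "W \<union> W' \<union> E \<in> lmeasurable"
      using W(1) W'(1) negligible_imp_measurable[OF E] by (intro fmeasurable.Un)
    ultimately have "s \<le> (\<Sum>r\<in>R. snd r - fst r) + measure lebesgue (W \<union> W' \<union> E)"
      using minH measure_covering_intervals[OF R(1) WE] unfolding s_def by (meson order_trans)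
    also have "measure lebesgue (W \<union> W' \<union> E) \<le> measure lebesgue (W \<union> W') + measure lebesgue E"
      using W(1) W'(1) negligible_imp_measurable[OF E] by (intro measure_Un_le) auto
    also have "measure lebesgue (W \<union> W') \<le> measure lebesgue W + measure lebesgue W'"
      using W(1) W'(1) by (intro measure_Un_le) auto
    finally have sR: "s - 2 * e \<le> (\<Sum>r\<in>R. snd r - fst r)"
      using W(2) W'(2) negligible_imp_measure0[OF E] by simp
    have sub: "\<exists>p\<in>P. fst p \<le> fst r \<and> snd r \<le> snd p" if r: "r \<in> R" for r
    proof -
      have "fst r \<in> U'" using R(2)[OF r] ltR[OF r] by auto
      then obtain p where p: "p \<in> P" "fst p < fst r" "fst r < snd p" by (auto simp: U'_def)
      have "snd r \<le> snd p"
      proof (rule ccontr)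
        assume "\<not> snd r \<le> snd p"
        then have "snd p \<in> {fst r..snd r}" using p by auto
        then have "snd p \<in> U'" using R(2)[OF r] by blast
        then obtain p' where p': "p' \<in> P" "fst p' < snd p" "snd p < snd p'" by (auto simp: U'_def)
        have "max (fst p) (fst p') < snd p" using ltP[OF p(1)] p' by simp
        then obtain y where "max (fst p) (fst p') < y" "y < snd p" using dense by blast
        then have "y \<in> {fst p<..<snd p} \<inter> {fst p'<..<snd p'}" using p' by auto
        moreover have "p \<noteq> p'" using p' by auto
        ultimately show False
          using P(1) p(1) p'(1) unfolding interval_family_def disjoint_family_on_def by blast
      qed
      with p show ?thesis by (auto intro!: bexI[of _ p])
    qed
    obtain T where T: "interval_family T" "\<And>t. t \<in> T \<Longrightarrow> \<exists>p\<in>P. fst p \<le> fst t \<and> snd t \<le> snd p"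
      and PRT: "\<And>f :: real \<Rightarrow> real. (\<Sum>p\<in>P. f (snd p) - f (fst p)) =
        (\<Sum>p\<in>R. f (snd p) - f (fst p)) + (\<Sum>p\<in>T. f (snd p) - f (fst p))"
      by (rule interval_family_gaps[OF P(1) R(1) sub]) (assumption, rule that)
    define lP lR lT where "lP = (\<Sum>r\<in>P. snd r - fst r)" and "lR = (\<Sum>r\<in>R. snd r - fst r)"
      and "lT = (\<Sum>r\<in>T. snd r - fst r)"
    define dP dR dT where "dP = (\<Sum>r\<in>P. h (snd r) - h (fst r))"
      and "dR = (\<Sum>r\<in>R. h (snd r) - h (fst r))" and "dT = (\<Sum>r\<in>T. h (snd r) - h (fst r))"
    have eqs: "lP = lR + lT" "dP = dR + dT"
      using PRT[of "\<lambda>x. x"] PRT[of h] by (simp_all add: lP_def lR_def lT_def dP_def dR_def dT_def)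
    have bounds: "lP < s + e" "s - 2 * e \<le> lR" using PU mU sR by (auto simp: lP_def lR_def)
    then have lT: "lT < 3 * e" using eqs by simp
    have lT0: "0 \<le> lT"
      unfolding lT_def using T(1) by (intro sum_nonneg) (auto simp: interval_family_def less_imp_le)
    have TJ: "{fst t..snd t} \<subseteq> J" if "t \<in> T" for t
    proof -
      obtain r where r: "r \<in> P" "fst r \<le> fst t" "snd t \<le> snd r" using T(2)[OF \<open>t \<in> T\<close>] by blast
      then have "{fst t..snd t} \<subseteq> {fst r..snd r}" by auto
      moreover have "{fst r..snd r} \<subseteq> J" using P(2)[OF r(1)] U(4) by blast
      ultimately show ?thesis by blast
    qed
    have "\<bar>dT\<bar> \<le> (\<Sum>r\<in>T. \<bar>h (snd r) - h (fst r)\<bar>)" unfolding dT_def by (rule sum_abs)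
    also have "\<dots> < \<epsilon>"
      using \<eta>(2)[OF T(1) TJ] lT e by (simp add: lT_def)
    finally have dT: "\<bar>dT\<bar> < \<epsilon>" .
    have "dP \<le> p * lP"
      unfolding dP_def lP_def sum_distrib_left using P(2) by (intro sum_mono) auto
    moreover have "q * lR \<le> dR"
      unfolding dR_def lR_def sum_distrib_left using R(2) by (intro sum_mono) auto
    ultimately have "(q - p) * lR \<le> \<epsilon> + p * lT"
      using eqs dT by (simp add: algebra_simps)
    also have "p * lT \<le> \<bar>p\<bar> * (3 * e)" using lT lT0 by (intro mult_mono) auto
    finally have "(q - p) * lR \<le> \<epsilon> + \<bar>p\<bar> * (3 * e)" by simp
    moreover have "(q - p) * (s - 2 * e) \<le> (q - p) * lR"
      using bounds \<open>p < q\<close> by (intro mult_left_mono) auto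
    ultimately have "(q - p) * s \<le> \<epsilon> + (2 * (q - p) + 3 * \<bar>p\<bar>) * e" by (simp add: algebra_simps)
    also have "\<dots> \<le> \<epsilon> + (2 * (q - p) + 3 * \<bar>p\<bar>) * \<epsilon>"
      using e \<open>p < q\<close> by (intro add_left_mono mult_left_mono) auto
    finally show ?thesis by (simp add: A_def algebra_simps)
  qed
  have "s \<le> 0"
  proof (rule ccontr)
    assume "\<not> s \<le> 0"
    then have "(q - p) * s > 0" using \<open>p < q\<close> by simp
    from main[of "(q - p) * s / (2 * A)"] this \<open>A > 0\<close> show False by (simp add: mult.commute)
  qed
  then have "measure lebesgue H = 0" using measure_nonneg[of lebesgue H] unfolding s_def by linarith
  then have "negligible H" using H(1) by (simp add: negligible_iff_measure)
  then show ?thesis using H(2) by (rule negligible_subset)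
qed

text \<open>
  Intervals of total length below \<open>\<eta>\<close> carry a total increment below 1. If all of them are steeper
  than \<open>1 / e\<close>, then their total length is in fact below \<open>e\<close>, so every piece of \<open>S\<close> of diameter below
  \<open>\<eta>\<close> is covered by sets of arbitrarily small measure.
\<close>

lemma negligible_infinite_slope:
  fixes S J :: "real set"
  assumes ac: "uniformly_abs_continuous_on J h" and J: "open J" "S \<subseteq> J"
    and steep: "\<And>x M d. x \<in> S \<Longrightarrow> d > 0 \<Longrightarrow>
      \<exists>u v. u < v \<and> u \<le> x \<and> x \<le> v \<and> v - u < d \<and> M * (v - u) \<le> \<bar>h v - h u\<bar>"
  shows "negligible S"
proof -
  obtain \<eta> where \<eta>: "\<eta> > 0"
      "\<And>P. interval_family P \<Longrightarrow> (\<And>p. p \<in> P \<Longrightarrow> {fst p..snd p} \<subseteq> J) \<Longrightarrow>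
        (\<Sum>p\<in>P. snd p - fst p) < \<eta> \<Longrightarrow> (\<Sum>p\<in>P. \<bar>h (snd p) - h (fst p)\<bar>) < 1"
    using uniformly_abs_continuous_onD[OF ac zero_less_one] by blast
  \<comment> \<open>Overlapping windows of length \<open>2 * \<eta> / 3\<close> that cover the line.\<close>
  define c where "c k = of_int k * (\<eta> / 3)" for k :: int
  have local: "negligible (S \<inter> {c k<..<c k + 2 * \<eta> / 3})" for k
    unfolding negligible_outer_le
  proof (intro allI impI)
    fix \<epsilon> :: real assume "\<epsilon> > 0"
    define e where "e = \<epsilon> / 2"
    have e: "e > 0" using \<open>\<epsilon> > 0\<close> by (simp add: e_def)
    define U where "U = J \<inter> {c k<..<c k + 2 * \<eta> / 3}"
    have U: "open U" "bounded U" "S \<inter> {c k<..<c k + 2 * \<eta> / 3} \<subseteq> U"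
      using J by (auto simp: U_def intro: bounded_subset[OF bounded_box, of _ "c k" "c k + 2 * \<eta> / 3"])
    have steep': "\<And>x d. x \<in> S \<inter> {c k<..<c k + 2 * \<eta> / 3} \<Longrightarrow> d > 0 \<Longrightarrow>
      \<exists>u v. u < v \<and> u \<le> x \<and> x \<le> v \<and> v - u < d \<and> 1 / e * (v - u) \<le> \<bar>h v - h u\<bar>"
      using steep by blast
    obtain P W where P: "interval_family P"
      "\<And>r. r \<in> P \<Longrightarrow> {fst r..snd r} \<subseteq> U \<and> 1 / e * (snd r - fst r) \<le> \<bar>h (snd r) - h (fst r)\<bar>"
      and W: "W \<in> lmeasurable" "measure lebesgue W < e"
        "S \<inter> {c k<..<c k + 2 * \<eta> / 3} \<subseteq> (\<Union>r\<in>P. {fst r..snd r}) \<union> W"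
      and PU: "(\<Sum>r\<in>P. snd r - fst r) \<le> measure lebesgue U"
      using Vitali_covering_intervals[where Q = "\<lambda>u v. 1 / e * (v - u) \<le> \<bar>h v - h u\<bar>", OF U e steep']
      by blast
    have "measure lebesgue U \<le> measure lebesgue (box (c k) (c k + 2 * \<eta> / 3))"
      using U by (intro measure_mono_fmeasurable lmeasurable_box) (auto simp: U_def)
    also have "\<dots> < \<eta>" using \<eta>(1) by simp
    finally have small: "(\<Sum>r\<in>P. snd r - fst r) < \<eta>" using PU by simp
    have "{fst r..snd r} \<subseteq> J" if "r \<in> P" for r using P(2)[OF that] by (auto simp: U_def)
    from \<eta>(2)[OF P(1) this small] have "(\<Sum>r\<in>P. \<bar>h (snd r) - h (fst r)\<bar>) < 1" by simp
    moreover have "1 / e * (\<Sum>r\<in>P. snd r - fst r) \<le> (\<Sum>r\<in>P. \<bar>h (snd r) - h (fst r)\<bar>)"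
      unfolding sum_distrib_left using P(2) by (intro sum_mono) auto
    ultimately have "1 / e * (\<Sum>r\<in>P. snd r - fst r) < 1" by simp
    then have "(\<Sum>r\<in>P. snd r - fst r) < e" using e by (simp add: field_simps)
    then have "measure lebesgue ((\<Union>r\<in>P. {fst r..snd r}) \<union> W) \<le> \<epsilon>"
      using measure_covering_intervals(2)[OF P(1) W(1)] W(2) by (simp add: e_def)
    then show "\<exists>T. S \<inter> {c k<..<c k + 2 * \<eta> / 3} \<subseteq> T \<and> T \<in> lmeasurable \<and> measure lebesgue T \<le> \<epsilon>"
      using W(3) measure_covering_intervals(1)[OF P(1) W(1)] by blast
  qed
  have "S \<subseteq> (\<Union>k. S \<inter> {c k<..<c k + 2 * \<eta> / 3})"
  proof
    fix x assume x: "x \<in> S"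
    define k where "k = \<lceil>x / (\<eta> / 3)\<rceil> - 1"
    have "of_int k < x / (\<eta> / 3)" "x / (\<eta> / 3) < of_int k + 2"
      unfolding k_def by linarith+
    then have "c k < x" "x < c k + 2 * \<eta> / 3"
      using \<eta>(1) by (auto simp: c_def field_simps)
    then show "x \<in> (\<Union>k. S \<inter> {c k<..<c k + 2 * \<eta> / 3})" using x by auto
  qed
  moreover have "negligible (\<Union>k. S \<inter> {c k<..<c k + 2 * \<eta> / 3})"
    using local by (intro negligible_countable_Union) auto
  ultimately show ?thesis by (rule negligible_subset[rotated])
qed

text \<open>
  Away from the points of infinite slope, the difference quotients at \<open>x\<close> are bounded, so their lower
  and upper limits are finite. If these differed, rationals \<open>p < q\<close> between them would put \<open>x\<close> in
  the null set of the pair \<open>(p, q)\<close>.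
\<close>

lemma abs_continuous_imp_AE_differentiable:
  fixes J :: "real set"
  assumes ac: "uniformly_abs_continuous_on J h" and J: "open J" "bounded J"
  shows "negligible {x \<in> J. \<not> h differentiable (at x)}"
proof -
  define Steep where "Steep = {x \<in> J. \<forall>M. \<forall>d>0. \<exists>u v. u < v \<and> u \<le> x \<and> x \<le> v \<and> v - u < d \<and>
      M * (v - u) \<le> \<bar>h v - h u\<bar>}"
  define Two where "Two = (\<lambda>(p, q). {x \<in> J.
      (\<forall>d>0. \<exists>u v. u < v \<and> u \<le> x \<and> x \<le> v \<and> v - u < d \<and> h v - h u \<le> p * (v - u)) \<and>
      (\<forall>d>0. \<exists>u v. u < v \<and> u \<le> x \<and> x \<le> v \<and> v - u < d \<and> q * (v - u) \<le> h v - h u)})"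
  define I where "I = {(p, q). p \<in> \<rat> \<and> q \<in> \<rat> \<and> p < (q::real)}"
  have "negligible Steep"
    by (rule negligible_infinite_slope[OF ac J(1)]) (auto simp: Steep_def)
  moreover have "negligible (\<Union>r\<in>I. Two r)"
  proof -
    have "negligible (Two r)" if "r \<in> I" for r
      using that unfolding I_def Two_def
      by (auto intro!: negligible_two_slopes[OF ac J, of _ "fst r" "snd r"])
    moreover have "countable I"
      by (rule countable_subset[of _ "\<rat> \<times> \<rat>"]) (auto simp: I_def countable_rat)
    ultimately show ?thesis by (intro negligible_countable_Union) auto
  qed
  ultimately have "negligible (Steep \<union> (\<Union>r\<in>I. Two r))" by (rule negligible_Un)
  moreover have "{x \<in> J. \<not> h differentiable (at x)} \<subseteq> Steep \<union> (\<Union>r\<in>I. Two r)"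
  proof clarify
    fix x assume x: "x \<in> J" "\<not> h differentiable (at x)" and notTwo: "x \<notin> (\<Union>r\<in>I. Two r)"
    show "x \<in> Steep"
    proof (rule ccontr)
      assume "x \<notin> Steep"
      then obtain M d where d: "d > 0"
        and M: "\<And>u v. u < v \<Longrightarrow> u \<le> x \<Longrightarrow> x \<le> v \<Longrightarrow> v - u < d \<Longrightarrow> \<bar>h v - h u\<bar> < M * (v - u)"
        using x(1) by (force simp: Steep_def not_le)
      define m where "m y = (h (x + y) - h x) / y" for y
      \<comment> \<open>A difference quotient with increment of either sign is the slope of an interval ending at \<open>x\<close>.\<close>
      have slope: "\<exists>u v. u < v \<and> u \<le> x \<and> x \<le> v \<and> v - u = \<bar>y\<bar> \<and> h v - h u = m y * (v - u)"
        if "y \<noteq> 0" for y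
      proof (cases "y > 0")
        case True
        then show ?thesis by (intro exI[of _ x] exI[of _ "x + y"]) (auto simp: m_def)
      next
        case False
        with that show ?thesis
          by (intro exI[of _ "x + y"] exI[of _ x]) (auto simp: m_def)
      qed
      have "eventually (\<lambda>y. \<bar>m y\<bar> \<le> M) (at 0)"
        unfolding eventually_at
      proof (intro exI[of _ d] conjI ballI impI)
        fix y :: real assume y: "y \<noteq> 0 \<and> dist y 0 < d"
        then obtain u v where uv: "u < v" "u \<le> x" "x \<le> v" "v - u = \<bar>y\<bar>" "h v - h u = m y * (v - u)"
          using slope by blast
        with M[of u v] y have "\<bar>m y * (v - u)\<bar> < M * (v - u)" by simp
        then show "\<bar>m y\<bar> \<le> M" using uv(1) by (simp add: abs_mult)
      qed (use d in auto)
      then have bd: "eventually (\<lambda>y. ereal (m y) \<le> ereal M) (at 0)"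
          "eventually (\<lambda>y. ereal (- M) \<le> ereal (m y)) (at 0)"
        by (auto elim!: eventually_mono)
      let ?L = "Liminf (at 0) (\<lambda>y. ereal (m y))" and ?U = "Limsup (at 0) (\<lambda>y. ereal (m y))"
      have le: "?L \<le> ?U" by (rule Liminf_le_Limsup) simp
      have "\<not> ?L < ?U"
      proof
        assume "?L < ?U"
        then obtain c where c: "?L < c" "c < ?U" using dense by blast
        obtain p where p: "?L < ereal (real_of_rat p)" "ereal (real_of_rat p) < c"
          using ereal_dense3[OF c(1)] by blast
        obtain q where q: "c < ereal (real_of_rat q)" "ereal (real_of_rat q) < ?U"
          using ereal_dense3[OF c(2)] by blast
        have "p < q" using p(2) q(1) by (metis ereal_less_eq(3) not_less of_rat_less order.strict_trans)
        have "\<exists>u v. u < v \<and> u \<le> x \<and> x \<le> v \<and> v - u < e \<and> h v - h u \<le> real_of_rat p * (v - u)"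
          if "e > 0" for e
        proof (rule ccontr)
          assume no: "\<not> ?thesis"
          have "eventually (\<lambda>y. ereal (real_of_rat p) \<le> ereal (m y)) (at 0)"
            unfolding eventually_at
          proof (intro exI[of _ e] conjI ballI impI)
            fix y :: real assume y: "y \<noteq> 0 \<and> dist y 0 < e"
            then obtain u v where uv: "u < v" "u \<le> x" "x \<le> v" "v - u = \<bar>y\<bar>" "h v - h u = m y * (v - u)"
              using slope by blast
            with no y have "real_of_rat p * (v - u) \<le> m y * (v - u)" by force
            then show "ereal (real_of_rat p) \<le> ereal (m y)" using uv(1) by simp
          qed (use that in auto)
          then have "ereal (real_of_rat p) \<le> ?L" by (rule Liminf_bounded)
          with p(1) show False by simp
        qed
        moreover have "\<exists>u v. u < v \<and> u \<le> x \<and> x \<le> v \<and> v - u < e \<and> real_of_rat q * (v - u) \<le> h v - h u"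
          if "e > 0" for e
        proof (rule ccontr)
          assume no: "\<not> ?thesis"
          have "eventually (\<lambda>y. ereal (m y) \<le> ereal (real_of_rat q)) (at 0)"
            unfolding eventually_at
          proof (intro exI[of _ e] conjI ballI impI)
            fix y :: real assume y: "y \<noteq> 0 \<and> dist y 0 < e"
            then obtain u v where uv: "u < v" "u \<le> x" "x \<le> v" "v - u = \<bar>y\<bar>" "h v - h u = m y * (v - u)"
              using slope by blast
            with no y have "m y * (v - u) \<le> real_of_rat q * (v - u)" by force
            then show "ereal (m y) \<le> ereal (real_of_rat q)" using uv(1) by simp
          qed (use that in auto)
          then have "?U \<le> ereal (real_of_rat q)" by (rule Limsup_bounded)
          with q(2) show False by simp
        qed
        ultimately have "x \<in> Two (real_of_rat p, real_of_rat q)" using x(1) by (simp add: Two_def)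
        moreover have "(real_of_rat p, real_of_rat q) \<in> I"
          using \<open>p < q\<close> by (simp add: I_def of_rat_less)
        ultimately show False using notTwo by blast
      qed
      then have eq: "?L = ?U" using le by simp
      have "?U \<le> ereal M" using bd(1) by (rule Limsup_bounded)
      moreover have "ereal (- M) \<le> ?L" using bd(2) by (rule Liminf_bounded)
      ultimately obtain l where l: "?U = ereal l" using eq by (cases ?U) auto
      have "((\<lambda>y. ereal (m y)) \<longlongrightarrow> ereal l) (at 0)"
        using eq l by (subst tendsto_iff_Liminf_eq_Limsup) auto
      then have "(m \<longlongrightarrow> l) (at 0)" by simp
      then have "DERIV h x :> l" by (simp add: DERIV_def m_def[abs_def])
      with x(2) show False by (auto simp: real_differentiable_def)
    qed
  qed
  ultimately show ?thesis by (rule negligible_subset)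
qed

section \<open>The fundamental theorem of calculus\<close>

text \<open>
  The gauge is the usual one at points of differentiability. At points of \<open>N\<close> it is an open set \<open>T\<close> of
  measure below \<open>\<eta>\<close>: in a fine division, the intervals tagged in \<open>N\<close> then have total length below
  \<open>\<eta>\<close>, hence a small total increment of \<open>h\<close>, while the integrand may be taken to be 0 on \<open>N\<close>.
\<close>

lemma fundamental_theorem_of_calculus_abs_continuous:
  fixes h D :: "real \<Rightarrow> real"
  assumes "a \<le> b" and ac: "uniformly_abs_continuous_on {a..b} h" and N: "negligible N"
    and D: "\<And>x. x \<in> {a..b} - N \<Longrightarrow> DERIV h x :> D x"
  shows "(D has_integral (h b - h a)) {a..b}"
proof (cases "a = b")
  case False
  then have ab: "a < b" using \<open>a \<le> b\<close> by simp
  define D0 where "D0 x = (if x \<in> N then 0 else D x)" for x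
  have "(D0 has_integral (h b - h a)) {a..b}"
    unfolding has_integral_factor_content box_real[symmetric]
  proof safe
    fix e :: real
    assume "e > 0"
    define \<epsilon> where "\<epsilon> = e / 2"
    have \<epsilon>: "\<epsilon> > 0" using \<open>e > 0\<close> by (simp add: \<epsilon>_def)
    have "\<exists>d>0. x \<in> {a..b} - N \<longrightarrow>
         (\<forall>y. norm (y-x) < d \<longrightarrow> norm (h y - h x - (y-x) *\<^sub>R D x) \<le> \<epsilon> * norm (y-x))" for x
    proof (cases "x \<in> {a..b} - N")
      case True
      then have "(h has_derivative (\<lambda>t. t *\<^sub>R D x)) (at x)"
        using D by (simp add: has_field_derivative_def mult_commute_abs)
      then show ?thesis using \<epsilon> unfolding has_derivative_at_alt by blast
    qed (auto intro: exI[of _ 1])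
    then obtain d where d: "\<And>x. 0 < d x"
        "\<And>x y. \<lbrakk>x \<in> {a..b} - N; norm (y-x) < d x\<rbrakk>
            \<Longrightarrow> norm (h y - h x - (y-x) *\<^sub>R D x) \<le> \<epsilon> * norm (y-x)"
      by metis
    obtain \<eta> where \<eta>: "\<eta> > 0"
      "\<And>P. interval_family P \<Longrightarrow> (\<And>p. p \<in> P \<Longrightarrow> {fst p..snd p} \<subseteq> {a..b}) \<Longrightarrow>
        (\<Sum>p\<in>P. snd p - fst p) < \<eta> \<Longrightarrow> (\<Sum>p\<in>P. \<bar>h (snd p) - h (fst p)\<bar>) < \<epsilon> * (b - a)"
      using uniformly_abs_continuous_onD[OF ac, of "\<epsilon> * (b - a)"] \<epsilon> ab by auto
    obtain T where T: "open T" "N \<subseteq> T" "T \<in> lmeasurable" "measure lebesgue T < \<eta>"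
      using lmeasurable_subset_open[OF negligible_imp_measurable[OF N] \<eta>(1)] negligible_imp_measure0[OF N]
      by auto
    define \<gamma> where "\<gamma> x = (if x \<in> N then T else ball x (d x))" for x
    show "\<exists>d. gauge d \<and> (\<forall>p. p tagged_division_of (cbox a b) \<and> d fine p \<longrightarrow>
      norm ((\<Sum>(x, k)\<in>p. measure lborel k *\<^sub>R D0 x) - (h b - h a)) \<le> e * measure lborel (cbox a b))"
    proof (rule exI[of _ \<gamma>], safe)
      show "gauge \<gamma>" using T d(1) by (auto simp: gauge_def \<gamma>_def)
    next
      fix p
      assume ptag: "p tagged_division_of cbox a b" and finep: "\<gamma> fine p"
      have finp: "finite p" using ptag by blast
      have K: "\<exists>u v. K = {u..v} \<and> u \<le> v \<and> x \<in> {u..v} \<and> {u..v} \<subseteq> {a..b} \<and> {u..v} \<subseteq> \<gamma> x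
          \<and> Inf K = u \<and> Sup K = v"
        if xK: "(x, K) \<in> p" for x K
      proof -
        have 1: "x \<in> K" "K \<subseteq> cbox a b" using ptag xK by blast+
        obtain u v where 2: "K = cbox u v" using tagged_division_ofD(4)[OF ptag xK] by blast
        have 3: "K \<subseteq> \<gamma> x" using finep xK by blast
        from 1 2 have "u \<le> v" by auto
        with 1 2 3 show ?thesis by (intro exI[of _ u] exI[of _ v]) auto
      qed
      define \<Delta> where "\<Delta> K = h (Sup K) - h (Inf K)" for K
      have ba: "b - a = (\<Sum>(x,K)\<in>p. Sup K - Inf K)" "h b - h a = (\<Sum>(x,K)\<in>p. \<Delta> K)"
        using additive_tagged_division_1[where f= "\<lambda>x. x"] additive_tagged_division_1[where f= h]
              \<open>a \<le> b\<close> ptag by (auto simp: \<Delta>_def)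
      \<comment> \<open>Degenerate intervals carry no increment and do not belong to an interval family.\<close>
      define pN where "pN = {(x, K) \<in> p. x \<in> N \<and> Inf K < Sup K}"
      define ends where "ends = (\<lambda>(x::real, K). (Inf K, Sup K :: real))"
      have finN: "finite pN" using finp by (auto simp: pN_def intro: finite_subset)
      have pNp: "pN \<subseteq> p" by (auto simp: pN_def)
      have disj: "{Inf (snd r)<..<Sup (snd r)} \<inter> {Inf (snd s)<..<Sup (snd s)} = {}"
        if "r \<in> pN" "s \<in> pN" "r \<noteq> s" for r s
      proof -
        obtain x K y L where rs: "r = (x, K)" "s = (y, L)" by (cases r, cases s)
        with that have 1: "(x, K) \<in> p" "(y, L) \<in> p" "(x, K) \<noteq> (y, L)" by (auto simp: pN_def)
        then have "interior K \<inter> interior L = {}"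
          using ptag tagged_division_ofD(5) by blast
        moreover have "interior K = {Inf K<..<Sup K}" "interior L = {Inf L<..<Sup L}"
          using K[OF 1(1)] K[OF 1(2)] interior_atLeastAtMost_real by metis+
        ultimately show ?thesis using rs by simp
      qed
      have inj: "inj_on ends pN"
      proof (rule inj_onI, rule ccontr)
        fix r s assume rs: "r \<in> pN" "s \<in> pN" "ends r = ends s" "r \<noteq> s"
        then have "Inf (snd r) = Inf (snd s)" "Sup (snd r) = Sup (snd s)" "Inf (snd r) < Sup (snd r)"
          by (auto simp: ends_def pN_def split_def)
        moreover from this(3) obtain y where "Inf (snd r) < y" "y < Sup (snd r)" using dense by blast
        ultimately have "y \<in> {Inf (snd r)<..<Sup (snd r)} \<inter> {Inf (snd s)<..<Sup (snd s)}" by simp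
        with disj[OF rs(1,2,4)] show False by blast
      qed
      have fam: "interval_family (ends ` pN)"
        unfolding interval_family_def
      proof (intro conjI)
        show "finite (ends ` pN)" using finN by simp
        show "\<forall>q\<in>ends ` pN. fst q < snd q" by (auto simp: ends_def pN_def)
        show "disjoint_family_on (\<lambda>q. {fst q<..<snd q}) (ends ` pN)"
          unfolding disjoint_family_on_def
        proof (intro ballI impI)
          fix q q' assume "q \<in> ends ` pN" "q' \<in> ends ` pN" "q \<noteq> q'"
          then obtain r s where "r \<in> pN" "s \<in> pN" "r \<noteq> s" "q = ends r" "q' = ends s" by blast
          then show "{fst q<..<snd q} \<inter> {fst q'<..<snd q'} = {}"
            using disj[of r s] by (simp add: ends_def split_def)
        qed
      qed
      have inT: "{fst q..snd q} \<subseteq> T \<and> {fst q..snd q} \<subseteq> {a..b}" if "q \<in> ends ` pN" for q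
      proof -
        obtain x L where xL: "(x, L) \<in> p" "x \<in> N" "q = (Inf L, Sup L)"
          using \<open>q \<in> ends ` pN\<close> by (auto simp: ends_def pN_def)
        obtain u v where uv: "{u..v} \<subseteq> {a..b}" "{u..v} \<subseteq> \<gamma> x" "Inf L = u" "Sup L = v"
          using K[OF xL(1)] by blast
        have "fst q = u" "snd q = v" using xL(3) uv(3,4) by simp_all
        then show ?thesis using uv(1,2) xL(2) by (simp add: \<gamma>_def)
      qed
      have "(\<Sum>q\<in>ends ` pN. snd q - fst q) \<le> measure lebesgue T"
        using inT by (intro interval_family_length_le[OF fam T(3)]) fastforce
      then have "(\<Sum>q\<in>ends ` pN. snd q - fst q) < \<eta>" using T(4) by simp
      from \<eta>(2)[OF fam _ this] inT
      have "(\<Sum>q\<in>ends ` pN. \<bar>h (snd q) - h (fst q)\<bar>) < \<epsilon> * (b - a)" by blast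
      then have sumN: "(\<Sum>(x, K)\<in>pN. \<bar>\<Delta> K\<bar>) < \<epsilon> * (b - a)"
        by (subst (asm) sum.reindex[OF inj]) (simp add: ends_def \<Delta>_def split_def)
      have each: "\<bar>measure lborel K *\<^sub>R D0 x - \<Delta> K\<bar> \<le>
          \<epsilon> * (Sup K - Inf K) + (if (x, K) \<in> pN then \<bar>\<Delta> K\<bar> else 0)"
        if xK: "(x, K) \<in> p" for x K
      proof -
        obtain u v where uv: "K = {u..v}" "u \<le> v" "x \<in> {u..v}" "{u..v} \<subseteq> {a..b}" "{u..v} \<subseteq> \<gamma> x"
          "Inf K = u" "Sup K = v" using K[OF xK] by blast
        show ?thesis
        proof (cases "x \<in> N")
          case True
          then have "D0 x = 0" by (simp add: D0_def)
          moreover have "(x, K) \<in> pN \<or> u = v" using True xK uv by (auto simp: pN_def)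
          moreover have "0 \<le> \<epsilon> * (v - u)" using uv(2) \<epsilon> by simp
          ultimately show ?thesis using uv by (auto simp: \<Delta>_def)
        next
          case False
          then have x: "x \<in> {a..b} - N" using uv by auto
          have "u \<in> ball x (d x)" "v \<in> ball x (d x)"
            using subsetD[OF uv(5), of u] subsetD[OF uv(5), of v] uv(2) False by (simp_all add: \<gamma>_def)
          then have "norm (u - x) < d x" "norm (v - x) < d x"
            by (auto simp: dist_real_def)
          from d(2)[OF x this(1)] d(2)[OF x this(2)]
          have "\<bar>h u - h x - (u - x) * D x\<bar> \<le> \<epsilon> * (x - u)" "\<bar>h v - h x - (v - x) * D x\<bar> \<le> \<epsilon> * (v - x)"
            using uv by auto
          then have "\<bar>(v - u) * D x - (h v - h u)\<bar> \<le> \<epsilon> * (v - u)"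
            by (auto simp: abs_le_iff algebra_simps)
          then show ?thesis using uv False by (auto simp: D0_def \<Delta>_def)
        qed
      qed
      have "norm ((\<Sum>(x, k)\<in>p. measure lborel k *\<^sub>R D0 x) - (h b - h a)) =
          \<bar>\<Sum>(x, K)\<in>p. measure lborel K *\<^sub>R D0 x - \<Delta> K\<bar>"
        by (simp add: ba split_def sum_subtractf)
      also have "\<dots> \<le> (\<Sum>(x, K)\<in>p. \<bar>measure lborel K *\<^sub>R D0 x - \<Delta> K\<bar>)"
        unfolding split_def by (rule sum_abs)
      also have "\<dots> \<le> (\<Sum>(x, K)\<in>p. \<epsilon> * (Sup K - Inf K) + (if (x, K) \<in> pN then \<bar>\<Delta> K\<bar> else 0))"
        using each by (intro sum_mono) auto
      also have "\<dots> = \<epsilon> * (b - a) + (\<Sum>(x, K)\<in>p. if (x, K) \<in> pN then \<bar>\<Delta> K\<bar> else 0)"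
        by (simp add: ba(1) split_def sum.distrib sum_distrib_left)
      also have "(\<Sum>(x, K)\<in>p. if (x, K) \<in> pN then \<bar>\<Delta> K\<bar> else 0) = (\<Sum>(x, K)\<in>pN. \<bar>\<Delta> K\<bar>)"
        using finp pNp by (simp add: split_def sum.inter_restrict[symmetric] Int_absorb1)
      also have "\<epsilon> * (b - a) + (\<Sum>(x, K)\<in>pN. \<bar>\<Delta> K\<bar>) \<le> e * (b - a)"
        using sumN by (simp add: \<epsilon>_def field_simps)
      finally show "norm ((\<Sum>(x, k)\<in>p. measure lborel k *\<^sub>R D0 x) - (h b - h a)) \<le> e * measure lborel (cbox a b)"
        using ab by simp
    qed
  qed
  then show ?thesis by (rule has_integral_spike[OF N, rotated]) (simp add: D0_def)
qed auto

section \<open>Piecewise absolutely continuous functions\<close>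

text \<open>
  The points of \<open>B\<close> need not be discontinuities. Describing the pieces as the intervals that avoid a
  finite set removes the enumeration of the break points from all further arguments.
\<close>

definition abs_continuous_off :: "real set \<Rightarrow> (real \<Rightarrow> real) \<Rightarrow> bool" where
  "abs_continuous_off B h \<longleftrightarrow> finite B \<and>
     (\<forall>J. is_interval J \<longrightarrow> bounded J \<longrightarrow> J \<inter> B = {} \<longrightarrow> uniformly_abs_continuous_on J h)"

lemma p_abs_continuous_imp_abs_continuous_off:
  assumes "p_abs_continuous h"
  obtains B where "abs_continuous_off B h"
proof -
  obtain m :: nat and \<delta> :: "nat \<Rightarrow> real" where m: "1 \<le> m"
    and left: "abs_continuous_on {..<\<delta> 1} h"
    and middle: "\<And>k. k \<in> {1..<m} \<Longrightarrow> abs_continuous_on {\<delta> k<..<\<delta> (Suc k)} h"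
    and right: "abs_continuous_on {\<delta> m<..} h"
    using assms unfolding p_abs_continuous_def by blast
  have "uniformly_abs_continuous_on J h"
    if J: "is_interval J" "bounded J" and JB: "J \<inter> \<delta> ` {1..m} = {}" for J
  proof -
    have "\<exists>I. J \<subseteq> I \<and> abs_continuous_on I h"
    proof (cases "J = {}")
      case False
      then obtain x where x: "x \<in> J" by blast
      have notin: "\<delta> k \<notin> J" if "k \<in> {1..m}" for k using that JB by blast
      have above: "y < \<delta> k" if "k \<in> {1..m}" "x < \<delta> k" "y \<in> J" for k y
        using mem_is_interval_1_I[OF J(1) x \<open>y \<in> J\<close>, of "\<delta> k"] notin[OF that(1)] that(2) by force
      have below: "\<delta> k < y" if "k \<in> {1..m}" "\<delta> k < x" "y \<in> J" for k y
        using mem_is_interval_1_I[OF J(1) \<open>y \<in> J\<close> x, of "\<delta> k"] notin[OF that(1)] that(2) by force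
      define K where "K = {k \<in> {1..m}. \<delta> k < x}"
      have out: "x < \<delta> k" if "k \<in> {1..m}" "k \<notin> K" for k
        using that x notin[OF that(1)] unfolding K_def by (cases "\<delta> k" x rule: linorder_cases) auto
      show ?thesis
      proof (cases "K = {}")
        case True
        then have "x < \<delta> 1" using out[of 1] m by auto
        then have "J \<subseteq> {..<\<delta> 1}" using above[of 1] m by auto
        with left show ?thesis by blast
      next
        case False
        define k where "k = Max K"
        have "finite K" by (simp add: K_def)
        then have kK: "k \<in> K" and kmax: "\<And>j. j \<in> K \<Longrightarrow> j \<le> k"
          using False by (auto simp: k_def)
        then have k: "k \<in> {1..m}" "\<delta> k < x" by (auto simp: K_def)
        show ?thesis
        proof (cases "k = m")
          case True
          with below k have "J \<subseteq> {\<delta> m<..}" by auto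
          with right show ?thesis by blast
        next
          case False
          with k have k': "k \<in> {1..<m}" "Suc k \<in> {1..m}" by auto
          have "Suc k \<notin> K" using kmax[of "Suc k"] by auto
          then have "J \<subseteq> {\<delta> k<..<\<delta> (Suc k)}" using below[OF k] above[OF k'(2) out[OF k'(2)]] by auto
          with middle[OF k'(1)] show ?thesis by blast
        qed
      qed
    qed (use left in blast)
    then show ?thesis using J unfolding abs_continuous_on_def by blast
  qed
  then show ?thesis by (intro that[of "\<delta> ` {1..m}"]) (auto simp: abs_continuous_off_def)
qed

lemma uniformly_abs_continuous_on_imp_uniformly_continuous_on:
  assumes J: "is_interval J" and ac: "uniformly_abs_continuous_on J h"
  shows "uniformly_continuous_on J h"
  unfolding uniformly_continuous_on_def
proof (intro allI impI)
  fix e :: real assume "e > 0"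
  obtain \<eta> where \<eta>: "\<eta> > 0"
      "\<And>P. interval_family P \<Longrightarrow> (\<And>p. p \<in> P \<Longrightarrow> {fst p..snd p} \<subseteq> J) \<Longrightarrow>
        (\<Sum>p\<in>P. snd p - fst p) < \<eta> \<Longrightarrow> (\<Sum>p\<in>P. \<bar>h (snd p) - h (fst p)\<bar>) < e"
    using uniformly_abs_continuous_onD[OF ac \<open>e > 0\<close>] by blast
  have close: "\<bar>h y - h x\<bar> < e" if "x \<in> J" "y \<in> J" "x < y" "y - x < \<eta>" for x y
  proof -
    have "interval_family {(x, y)}" using that by (simp add: interval_family_def disjoint_family_on_def)
    moreover have "{x..y} \<subseteq> J" using mem_is_interval_1_I[OF J that(1,2)] by auto
    ultimately show ?thesis using \<eta>(2)[of "{(x, y)}"] that by simp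
  qed
  show "\<exists>d>0. \<forall>x\<in>J. \<forall>x'\<in>J. dist x' x < d \<longrightarrow> dist (h x') (h x) < e"
  proof (intro exI[of _ \<eta>] conjI ballI impI)
    fix x x' assume "x \<in> J" "x' \<in> J" "dist x' x < \<eta>"
    then show "dist (h x') (h x) < e"
      using close[of x x'] close[of x' x] \<open>e > 0\<close>
      by (cases x x' rule: linorder_cases) (auto simp: dist_real_def abs_minus_commute)
  qed (use \<eta> in auto)
qed

lemma abs_continuous_off_punctured:
  assumes "abs_continuous_off B h"
  obtains r where "r > 0" "\<And>y. y \<noteq> t \<Longrightarrow> \<bar>y - t\<bar> < r \<Longrightarrow> y \<notin> B"
proof -
  have "finite B" using assms by (simp add: abs_continuous_off_def)
  then obtain r where "r > 0" "\<forall>y\<in>B. y \<noteq> t \<longrightarrow> r \<le> dist t y"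
    using finite_set_avoid[of B t] by blast
  then show ?thesis by (intro that[of r]) (auto simp: dist_real_def abs_minus_commute)
qed

lemma abs_continuous_off_uniformly_continuous_on:
  assumes ac: "abs_continuous_off B h" and J: "is_interval J" "bounded J" "J \<inter> B = {}"
  shows "uniformly_continuous_on J h"
  using assms uniformly_abs_continuous_on_imp_uniformly_continuous_on
  unfolding abs_continuous_off_def by blast

lemma abs_continuous_off_one_sided_limits:
  assumes ac: "abs_continuous_off B h"
  shows "(h \<longlongrightarrow> left_limit h t) (at_left t)" "(h \<longlongrightarrow> right_limit h t) (at_right t)"
proof -
  obtain r where r: "r > 0" "\<And>y. y \<noteq> t \<Longrightarrow> \<bar>y - t\<bar> < r \<Longrightarrow> y \<notin> B"
    using abs_continuous_off_punctured[OF ac] by blast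
  have "uniformly_continuous_on {t - r<..<t} h"
    using r(2) by (intro abs_continuous_off_uniformly_continuous_on[OF ac]) auto
  then obtain l where "(h \<longlongrightarrow> l) (at t within {t - r<..<t})"
    using uniformly_continuous_on_extension_at_closure[of "{t - r<..<t}" h t] r(1) by auto
  moreover have "at t within {t - r<..<t} = at_left t"
    using r(1) by (intro at_within_nhd[of t "{t - r<..<t + r}"]) auto
  ultimately have "(h \<longlongrightarrow> l) (at_left t)" by simp
  then show "(h \<longlongrightarrow> left_limit h t) (at_left t)"
    unfolding left_limit_def by (metis tendsto_Lim trivial_limit_at_left_real)
  have "uniformly_continuous_on {t<..<t + r} h"
    using r(2) by (intro abs_continuous_off_uniformly_continuous_on[OF ac]) auto
  then obtain l where "(h \<longlongrightarrow> l) (at t within {t<..<t + r})"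
    using uniformly_continuous_on_extension_at_closure[of "{t<..<t + r}" h t] r(1) by auto
  moreover have "at t within {t<..<t + r} = at_right t"
    using r(1) by (intro at_within_nhd[of t "{t - r<..<t + r}"]) auto
  ultimately have "(h \<longlongrightarrow> l) (at_right t)" by simp
  then show "(h \<longlongrightarrow> right_limit h t) (at_right t)"
    unfolding right_limit_def by (metis tendsto_Lim trivial_limit_at_right_real)
qed

lemma abs_continuous_off_isCont:
  assumes ac: "abs_continuous_off B h" and "t \<notin> B"
  shows "isCont h t"
proof -
  obtain r where r: "r > 0" "\<And>y. y \<noteq> t \<Longrightarrow> \<bar>y - t\<bar> < r \<Longrightarrow> y \<notin> B"
    using abs_continuous_off_punctured[OF ac] by blast
  have "y \<notin> B" if "\<bar>y - t\<bar> < r" for y using r(2)[of y] that \<open>t \<notin> B\<close> by (cases "y = t") auto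
  then have "uniformly_continuous_on {t - r<..<t + r} h"
    by (intro abs_continuous_off_uniformly_continuous_on[OF ac]) (auto simp: abs_less_iff)
  then have "continuous_on {t - r<..<t + r} h" by (rule uniformly_continuous_imp_continuous)
  then show ?thesis using r(1) by (auto simp: continuous_on_eq_continuous_at)
qed

text \<open>
  The complement of \<open>B\<close> is a countable union of bounded intervals with rational end points.
\<close>

lemma abs_continuous_off_negligible_not_differentiable:
  assumes ac: "abs_continuous_off B h"
  shows "negligible {t. \<not> h differentiable (at t)}"
proof -
  define I where "I = {(p, q). p \<in> \<rat> \<and> q \<in> \<rat> \<and> {p<..<q} \<inter> B = {}}"
  define N where "N = (\<lambda>(p, q). {t \<in> {p<..<q}. \<not> h differentiable (at t)})"
  have "negligible (N r)" if r: "r \<in> I" for r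
  proof -
    obtain p q where pq: "r = (p, q)" "{p<..<q} \<inter> B = {}" using r by (auto simp: I_def)
    with ac have "uniformly_abs_continuous_on {p<..<q} h" by (simp add: abs_continuous_off_def)
    then show ?thesis unfolding pq N_def prod.case by (rule abs_continuous_imp_AE_differentiable) auto
  qed
  moreover have "countable I"
    by (rule countable_subset[of _ "\<rat> \<times> \<rat>"]) (auto simp: I_def countable_rat)
  ultimately have "negligible (\<Union>r\<in>I. N r)" by (intro negligible_countable_Union) auto
  moreover have "negligible B" using ac by (auto simp: abs_continuous_off_def)
  ultimately have "negligible (B \<union> (\<Union>r\<in>I. N r))" by simp
  moreover have "{t. \<not> h differentiable (at t)} \<subseteq> B \<union> (\<Union>r\<in>I. N r)"
  proof clarify
    fix t assume t: "\<not> h differentiable (at t)" "t \<notin> (\<Union>r\<in>I. N r)"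
    show "t \<in> B"
    proof (rule ccontr)
      assume "t \<notin> B"
      obtain r where r: "r > 0" "\<And>y. y \<noteq> t \<Longrightarrow> \<bar>y - t\<bar> < r \<Longrightarrow> y \<notin> B"
        using abs_continuous_off_punctured[OF ac] by blast
      obtain p where p: "p \<in> \<rat>" "t - r < p" "p < t" using Rats_dense_in_real[of "t - r" t] r(1) by auto
      obtain q where q: "q \<in> \<rat>" "t < q" "q < t + r" using Rats_dense_in_real[of t "t + r"] r(1) by auto
      have "y \<notin> B" if "y \<in> {p<..<q}" for y
        using r(2)[of y] that p q \<open>t \<notin> B\<close> by (cases "y = t") (auto simp: abs_less_iff)
      then have "(p, q) \<in> I" using p q by (auto simp: I_def)
      moreover have "t \<in> N (p, q)" using p q t(1) by (simp add: N_def)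
      ultimately show False using t(2) by blast
    qed
  qed
  ultimately show ?thesis by (rule negligible_subset)
qed

definition jump :: "(real \<Rightarrow> real) \<Rightarrow> real \<Rightarrow> real" where
  "jump h t = right_limit h t - left_limit h t"

text \<open>
  Subtracting the steps of the jumps leaves a function that can be made continuous; starting from the
  left limit instead of from \<open>h\<close> assigns the right value at the jump points themselves.
\<close>

definition continuous_part :: "(real \<Rightarrow> real) \<Rightarrow> real \<Rightarrow> real" where
  "continuous_part h t = left_limit h t - (\<Sum>\<delta>\<in>discontinuity_set h. jump h \<delta> * indicator {\<delta><..} t)"

lemma left_limit_eq: "isCont h t \<Longrightarrow> left_limit h t = h t"
  unfolding left_limit_def isCont_def
  by (intro tendsto_Lim) (auto intro: filterlim_mono at_le)

lemma discontinuity_set_subset: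
  assumes "abs_continuous_off B h"
  shows "discontinuity_set h \<subseteq> B" "finite (discontinuity_set h)"
proof -
  show 1: "discontinuity_set h \<subseteq> B"
    using abs_continuous_off_isCont[OF assms] by (auto simp: discontinuity_set_def)
  show "finite (discontinuity_set h)"
    using 1 assms by (auto simp: abs_continuous_off_def intro: finite_subset)
qed

lemma continuous_part_eq:
  assumes "t \<notin> discontinuity_set h"
  shows "h t = continuous_part h t + (\<Sum>\<delta>\<in>discontinuity_set h. jump h \<delta> * indicator {\<delta><..} t)"
  using assms left_limit_eq[where h = h and t = t] by (simp add: continuous_part_def discontinuity_set_def)

text \<open>
  Near \<open>t\<close>, the step function is constant to the left of \<open>t\<close>, and to the right of \<open>t\<close> it has grown
  by the jump at \<open>t\<close>, which is 0 at a point of continuity.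
\<close>

lemma isCont_continuous_part:
  assumes ac: "abs_continuous_off B h"
  shows "isCont (continuous_part h) t"
proof -
  let ?S = "discontinuity_set h"
  have fin: "finite ?S" by (rule discontinuity_set_subset[OF ac])
  obtain r where r: "r > 0" "\<And>y. y \<noteq> t \<Longrightarrow> \<bar>y - t\<bar> < r \<Longrightarrow> y \<notin> ?S"
    using abs_continuous_off_punctured[OF ac] discontinuity_set_subset(1)[OF ac] by (metis subsetD)
  note lim = abs_continuous_off_one_sided_limits[OF ac, of t]
  have step_left: "(\<Sum>\<delta>\<in>?S. jump h \<delta> * indicator {\<delta><..} y) = (\<Sum>\<delta>\<in>?S. jump h \<delta> * indicator {\<delta><..} t)"
    if y: "t - r < y" "y < t" for y
  proof (rule sum.cong[OF refl])
    fix \<delta> assume "\<delta> \<in> ?S"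
    then have "\<not> (y \<le> \<delta> \<and> \<delta> < t)" using r(2)[of \<delta>] y by auto
    then have "indicator {\<delta><..} y = (indicator {\<delta><..} t :: real)" using y by (auto simp: indicator_def)
    then show "jump h \<delta> * indicator {\<delta><..} y = jump h \<delta> * indicator {\<delta><..} t" by simp
  qed
  have step_right: "(\<Sum>\<delta>\<in>?S. jump h \<delta> * indicator {\<delta><..} y) =
      (\<Sum>\<delta>\<in>?S. jump h \<delta> * indicator {\<delta><..} t) + (right_limit h t - left_limit h t)"
    if y: "t < y" "y < t + r" for y
  proof -
    have "(\<Sum>\<delta>\<in>?S. jump h \<delta> * indicator {\<delta><..} y) =
        (\<Sum>\<delta>\<in>?S. jump h \<delta> * indicator {\<delta><..} t + (if \<delta> = t then jump h t else 0))"
    proof (rule sum.cong[OF refl])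
      fix \<delta> assume "\<delta> \<in> ?S"
      then have "\<not> (t < \<delta> \<and> \<delta> \<le> y)" using r(2)[of \<delta>] y by auto
      then show "jump h \<delta> * indicator {\<delta><..} y =
          jump h \<delta> * indicator {\<delta><..} t + (if \<delta> = t then jump h t else 0)"
        using y by (auto simp: indicator_def)
    qed
    also have "\<dots> = (\<Sum>\<delta>\<in>?S. jump h \<delta> * indicator {\<delta><..} t) + (if t \<in> ?S then jump h t else 0)"
      using fin by (simp add: sum.distrib sum.delta)
    also have "(if t \<in> ?S then jump h t else 0) = right_limit h t - left_limit h t"
    proof (cases "t \<in> ?S")
      case False
      then have "isCont h t" by (simp add: discontinuity_set_def)
      then have "(h \<longlongrightarrow> h t) (at_right t)" unfolding isCont_def by (auto intro: filterlim_mono at_le)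
      with lim(2) have "right_limit h t = h t"
        by (rule tendsto_unique[OF trivial_limit_at_right_real])
      then show ?thesis using False left_limit_eq[OF \<open>isCont h t\<close>] by simp
    qed (simp add: jump_def)
    finally show ?thesis .
  qed
  have ll: "left_limit h y = h y" if "y \<noteq> t" "\<bar>y - t\<bar> < r" for y
    using r(2)[OF that] by (intro left_limit_eq) (simp add: discontinuity_set_def)
  let ?c = "\<Sum>\<delta>\<in>?S. jump h \<delta> * indicator {\<delta><..} t"
  have "((\<lambda>y. h y - ?c) \<longlongrightarrow> continuous_part h t) (at_left t)"
    unfolding continuous_part_def by (intro tendsto_intros lim)
  moreover have "eventually (\<lambda>y. h y - ?c = continuous_part h y) (at_left t)"
    unfolding eventually_at_left_field
    by (rule exI[of _ "t - r"]) (use r(1) ll step_left in \<open>auto simp: continuous_part_def\<close>)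
  ultimately have L: "(continuous_part h \<longlongrightarrow> continuous_part h t) (at_left t)"
    by (rule Lim_transform_eventually)
  have "((\<lambda>y. h y - (?c + (right_limit h t - left_limit h t))) \<longlongrightarrow>
      right_limit h t - (?c + (right_limit h t - left_limit h t))) (at_right t)"
    by (intro tendsto_intros lim)
  then have "((\<lambda>y. h y - (?c + (right_limit h t - left_limit h t))) \<longlongrightarrow> continuous_part h t) (at_right t)"
    by (simp add: continuous_part_def algebra_simps)
  moreover have "eventually (\<lambda>y. h y - (?c + (right_limit h t - left_limit h t)) = continuous_part h y) (at_right t)"
    unfolding eventually_at_right_field
    by (rule exI[of _ "t + r"]) (use r(1) ll step_right in \<open>auto simp: continuous_part_def\<close>)
  ultimately have R: "(continuous_part h \<longlongrightarrow> continuous_part h t) (at_right t)"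
    by (rule Lim_transform_eventually)
  show ?thesis using L R by (simp add: isCont_def filterlim_split_at_real)
qed

text \<open>
  The difference between the continuous part and the indefinite integral of \<open>D\<close> is continuous and, by
  the fundamental theorem on the pieces, locally constant off the finite set \<open>B\<close>; hence it is constant.
\<close>

lemma continuous_part_integral:
  fixes h D :: "real \<Rightarrow> real"
  assumes ac: "abs_continuous_off B h" and N: "negligible N"
    and D: "\<And>x. x \<notin> N \<Longrightarrow> DERIV h x :> D x"
    and int: "D integrable_on {u..v}" and "u \<le> v"
  shows "continuous_part h v - continuous_part h u = integral {u..v} D"
proof -
  define f where "f t = continuous_part h t - integral {u..t} D" for t
  have fin: "finite (B \<union> {u, v})" using ac by (simp add: abs_continuous_off_def)
  have "f v = f u"
  proof (rule has_derivative_zero_unique_strong_interval[OF fin, where f = f and a = u and b = v])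
    show "continuous_on {u..v} f"
      unfolding f_def using isCont_continuous_part[OF ac] int
      by (intro continuous_intros indefinite_integral_continuous_1 continuous_at_imp_continuous_on) auto
    show "(f has_derivative (\<lambda>h. 0)) (at x within {u..v})" if x: "x \<in> {u..v} - (B \<union> {u, v})" for x
    proof -
      obtain r0 where r0: "r0 > 0" "\<And>y. y \<noteq> x \<Longrightarrow> \<bar>y - x\<bar> < r0 \<Longrightarrow> y \<notin> B"
        using abs_continuous_off_punctured[OF ac] by blast
      define r where "r = min r0 (min (x - u) (v - x))"
      have r: "r > 0" "r \<le> r0" "u \<le> x - r" "x + r \<le> v" using r0(1) x by (auto simp: r_def)
      have noB: "y \<notin> B" if "y \<in> {x - r<..<x + r}" for y
        using r0(2)[of y] r x that by (cases "y = x") (auto simp: abs_less_iff)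
      have const: "f z = f y" if yz: "y \<in> {x - r<..<x + r}" "z \<in> {x - r<..<x + r}" "y \<le> z" for y z
      proof -
        have yzB: "{y..z} \<inter> B = {}" using yz noB by fastforce
        then have "uniformly_abs_continuous_on {y..z} h"
          using ac by (auto simp: abs_continuous_off_def is_interval_cc)
        then have "(D has_integral (h z - h y)) {y..z}"
          using yz(3) N D by (intro fundamental_theorem_of_calculus_abs_continuous) auto
        then have 1: "integral {y..z} D = h z - h y" by (rule integral_unique)
        have "D integrable_on {u..z}" using int by (rule integrable_on_subinterval) (use yz r in auto)
        then have 2: "integral {u..y} D + integral {y..z} D = integral {u..z} D"
          using yz r by (intro Henstock_Kurzweil_Integration.integral_combine) auto
        have S: "discontinuity_set h \<inter> {y..z} = {}" using yzB discontinuity_set_subset(1)[OF ac] by blast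
        have 3: "(\<Sum>\<delta>\<in>discontinuity_set h. jump h \<delta> * indicator {\<delta><..} z) =
            (\<Sum>\<delta>\<in>discontinuity_set h. jump h \<delta> * indicator {\<delta><..} y)"
        proof (rule sum.cong[OF refl])
          fix \<delta> assume "\<delta> \<in> discontinuity_set h"
          then have "\<not> (y \<le> \<delta> \<and> \<delta> \<le> z)" using S by auto
          then show "jump h \<delta> * indicator {\<delta><..} z = jump h \<delta> * indicator {\<delta><..} y"
            using yz(3) by (auto simp: indicator_def)
        qed
        have "y \<notin> discontinuity_set h" "z \<notin> discontinuity_set h" using S yz(3) by auto
        with continuous_part_eq[of y h] continuous_part_eq[of z h] 1 2 3 show ?thesis
          by (simp add: f_def)
      qed
      have "(f has_derivative (\<lambda>h. 0)) (at x)"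
      proof (rule has_derivative_transform_within_open[of "\<lambda>_. f x" _ _ _ "{x - r<..<x + r}"])
        show "f x = f y" if "y \<in> {x - r<..<x + r}" for y
          using const[of x y] const[of y x] that r(1) by (cases "x \<le> y") auto
      qed (use r(1) in auto)
      then show ?thesis by (rule has_derivative_at_withinI)
    qed
  qed (use \<open>u \<le> v\<close> in auto)
  then show ?thesis by (simp add: f_def)
qed

section \<open>The identity on the line\<close>

lemma DERIV_normal_density:
  assumes "\<sigma> > 0"
  shows "(normal_density m \<sigma> has_real_derivative - ((t - m) / \<sigma>\<^sup>2 * normal_density m \<sigma> t)) (at t)"
proof -
  have "((\<lambda>t. - (t - m)\<^sup>2 / (2 * \<sigma>\<^sup>2)) has_real_derivative - ((t - m) / \<sigma>\<^sup>2)) (at t)"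
    using assms by (auto intro!: derivative_eq_intros simp: divide_simps) (simp add: algebra_simps power4_eq_xxxx power2_eq_square)
  from DERIV_cmult[OF DERIV_fun_exp[OF this], of "1 / sqrt (2 * pi * \<sigma>\<^sup>2)"]
  show ?thesis by (simp add: normal_density_def[abs_def] mult_ac)
qed

lemma normal_density_at_top:
  assumes "\<sigma> > 0"
  shows "(normal_density m \<sigma> \<longlongrightarrow> 0) at_top"
proof -
  have "filterlim (\<lambda>t. - m + t) at_top at_top"
    by (rule filterlim_tendsto_add_at_top[OF tendsto_const filterlim_ident])
  then have "filterlim (\<lambda>t. (t - m)\<^sup>2) at_top at_top"
    by (intro filterlim_pow_at_top) (auto simp: add.commute)
  then have "filterlim (\<lambda>t. (t - m)\<^sup>2 * (1 / (2 * \<sigma>\<^sup>2))) at_top at_top"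
    by (rule filterlim_at_top_mult_tendsto_pos[OF tendsto_const, rotated]) (use assms in simp)
  then have "filterlim (\<lambda>t. - ((t - m)\<^sup>2) / (2 * \<sigma>\<^sup>2)) at_bot at_top"
    by (simp add: filterlim_uminus_at_top)
  then have "((\<lambda>t. exp (- ((t - m)\<^sup>2) / (2 * \<sigma>\<^sup>2))) \<longlongrightarrow> 0) at_top"
    by (rule filterlim_compose[OF exp_at_bot])
  then have "((\<lambda>t. 1 / sqrt (2 * pi * \<sigma>\<^sup>2) * exp (- ((t - m)\<^sup>2) / (2 * \<sigma>\<^sup>2))) \<longlongrightarrow> 0) at_top"
    by (rule tendsto_mult_right_zero)
  then show ?thesis by (simp add: normal_density_def[abs_def])
qed

lemma normal_score_integral:
  assumes "\<sigma> > 0"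
  shows "has_bochner_integral lborel (\<lambda>t. (t - m) / \<sigma>\<^sup>2 * normal_density m \<sigma> t) 0"
proof -
  have "has_bochner_integral lborel (\<lambda>x. normal_density m \<sigma> x * (x - m)) 0"
    using normal_moment_odd[OF assms, of m 0] by simp
  then have "has_bochner_integral lborel (\<lambda>x. 1 / \<sigma>\<^sup>2 * (normal_density m \<sigma> x * (x - m))) (1 / \<sigma>\<^sup>2 * 0)"
    by (rule has_bochner_integral_mult_right)
  then show ?thesis by (simp add: field_simps)
qed

text \<open>
  The integrand is the derivative of minus the density, which vanishes at infinity. The identity is
  both the contribution of a unit jump at \<open>s\<close> and the inner integral in the proof of
  \<open>Stein_continuous\<close>.
\<close>

lemma normal_score_tail:
  assumes "\<sigma> > 0"
  shows "has_bochner_integral lborel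
    (\<lambda>t. indicator {s<..} t * ((t - m) / \<sigma>\<^sup>2 * normal_density m \<sigma> t)) (normal_density m \<sigma> s)"
proof -
  let ?f = "\<lambda>t. (t - m) / \<sigma>\<^sup>2 * normal_density m \<sigma> t"
  have int: "integrable lborel ?f"
    using normal_score_integral[OF assms] by (rule integrable.intros)
  have e: "einterval (ereal s) \<infinity> = {s<..}" by (auto simp: einterval_def)
  have si: "set_integrable lborel (einterval (ereal s) \<infinity>) ?f"
    unfolding set_integrable_def e using integrable_mult_indicator[OF _ int, of "{s<..}"] by simp
  have "(LBINT t=ereal s..\<infinity>. ?f t) = 0 - (- normal_density m \<sigma> s)"
  proof (rule interval_integral_FTC_integrable[OF _ _ _ si])
    show "((\<lambda>t. - normal_density m \<sigma> t) has_vector_derivative ?f t) (at t)" for t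
      using DERIV_minus[OF DERIV_normal_density[OF assms, of m t]]
      by (simp add: has_real_derivative_iff_has_vector_derivative)
    show "isCont ?f t" for t
      using DERIV_isCont[OF DERIV_normal_density[OF assms, of m t]] by (intro continuous_intros) (use assms in auto)
    show "(((\<lambda>t. - normal_density m \<sigma> t) \<circ> real_of_ereal) \<longlongrightarrow> - normal_density m \<sigma> s) (at_right (ereal s))"
      using DERIV_isCont[OF DERIV_normal_density[OF assms, of m s]]
      by (auto simp: ereal_tendsto_simps1 isCont_def intro!: tendsto_minus intro: filterlim_mono at_le)
    show "(((\<lambda>t. - normal_density m \<sigma> t) \<circ> real_of_ereal) \<longlongrightarrow> 0) (at_left \<infinity>)"
      using tendsto_minus[OF normal_density_at_top[OF assms, of m]] by (simp add: ereal_tendsto_simps1)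
  qed auto
  then have "(LINT t|lborel. indicator {s<..} t * ?f t) = normal_density m \<sigma> s"
    by (simp add: interval_lebesgue_integral_def set_lebesgue_integral_def e)
  then show ?thesis using si by (simp add: has_bochner_integral_iff set_integrable_def e)
qed

lemma normal_score_lower:
  assumes "\<sigma> > 0"
  shows "has_bochner_integral lborel
    (\<lambda>t. indicator {..<s} t * ((t - m) / \<sigma>\<^sup>2 * normal_density m \<sigma> t)) (- normal_density m \<sigma> s)"
proof -
  have "has_bochner_integral lborel (\<lambda>t. (t - m) / \<sigma>\<^sup>2 * normal_density m \<sigma> t -
      indicator {s<..} t * ((t - m) / \<sigma>\<^sup>2 * normal_density m \<sigma> t)) (0 - normal_density m \<sigma> s)"
    by (intro has_bochner_integral_diff normal_score_integral normal_score_tail assms)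
  then have "has_bochner_integral lborel (\<lambda>t. (t - m) / \<sigma>\<^sup>2 * normal_density m \<sigma> t -
      indicator {s<..} t * ((t - m) / \<sigma>\<^sup>2 * normal_density m \<sigma> t)) (- normal_density m \<sigma> s)"
    by simp
  then show ?thesis
  proof (rule has_bochner_integralI_AE)
    show "AE t in lborel. (t - m) / \<sigma>\<^sup>2 * normal_density m \<sigma> t -
        indicator {s<..} t * ((t - m) / \<sigma>\<^sup>2 * normal_density m \<sigma> t) =
        indicator {..<s} t * ((t - m) / \<sigma>\<^sup>2 * normal_density m \<sigma> t)"
      using AE_lborel_singleton[of s] by eventually_elim (auto simp: indicator_def)
  qed simp
qed

text \<open>
  The density is bounded away from 0 on bounded intervals.
\<close>

lemma set_integrable_of_normal_weight:
  fixes D :: "real \<Rightarrow> real"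
  assumes "\<sigma> > 0" and D: "D \<in> borel_measurable borel"
    and int: "integrable lborel (\<lambda>t. D t * normal_density m \<sigma> t)"
  shows "set_integrable lborel {u..v} D"
proof -
  let ?w = "normal_density m \<sigma>"
  have cont: "continuous_on {u..v} (\<lambda>t. 1 / ?w t)"
    using DERIV_isCont[OF DERIV_normal_density[OF \<open>\<sigma> > 0\<close>, of m]] normal_density_pos[OF \<open>\<sigma> > 0\<close>, of m]
    by (intro continuous_intros continuous_at_imp_continuous_on ballI) (auto simp: less_le)
  then have "bounded ((\<lambda>t. 1 / ?w t) ` {u..v})"
    by (intro compact_imp_bounded compact_continuous_image) auto
  then obtain C where "\<forall>y\<in>(\<lambda>t. 1 / ?w t) ` {u..v}. norm y \<le> C"
    unfolding bounded_iff by blast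
  then have C: "\<bar>1 / ?w t\<bar> \<le> C" if "t \<in> {u..v}" for t using that by (simp del: abs_divide)
  have "integrable lborel (\<lambda>t. C * (D t * ?w t))" using int by simp
  then show ?thesis
    unfolding set_integrable_def
  proof (rule Bochner_Integration.integrable_bound)
    show "AE t in lborel. norm (indicator {u..v} t *\<^sub>R D t) \<le> norm (C * (D t * ?w t))"
    proof (rule AE_I2)
      fix t
      show "norm (indicator {u..v} t *\<^sub>R D t) \<le> norm (C * (D t * ?w t))"
      proof (cases "t \<in> {u..v}")
        case True
        have w: "?w t > 0" using normal_density_pos[OF \<open>\<sigma> > 0\<close>] by simp
        then have "1 \<le> C * ?w t" using C[OF True] by (simp add: field_simps)
        then have "\<bar>D t\<bar> * 1 \<le> \<bar>D t\<bar> * (C * ?w t)" by (intro mult_left_mono) auto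
        also have "\<dots> = \<bar>C * (D t * ?w t)\<bar>"
          using w \<open>1 \<le> C * ?w t\<close> by (simp add: abs_mult zero_less_mult_iff)
             (smt (verit) mult_nonneg_nonpos zero_less_mult_iff)
        finally show ?thesis using True by simp
      qed auto
    qed
  qed (use D in measurable)
qed

text \<open>
  With \<open>\<psi>\<close> the weight \<open>(t - m) / \<sigma>\<^sup>2 * w(t)\<close> and \<open>\<kappa> s t\<close> the signed indicator of \<open>s\<close> lying between \<open>m\<close>
  and \<open>t\<close>, one has \<open>k(t) - k(m) = \<integral> D(s) * \<kappa> s t ds\<close> and \<open>\<integral> \<kappa> s t * \<psi>(t) dt = w(s)\<close>, so the claim is
  Fubini's theorem for \<open>D(s) * \<kappa> s t * \<psi>(t)\<close>. The constant \<open>k(m)\<close> drops out since \<open>\<psi>\<close> has integral 0.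
\<close>

lemma Stein_continuous:
  fixes k D :: "real \<Rightarrow> real"
  assumes \<sigma>: "\<sigma> > 0" and D[measurable]: "D \<in> borel_measurable borel"
    and int: "integrable lborel (\<lambda>t. D t * normal_density m \<sigma> t)"
    and k: "\<And>u v. u \<le> v \<Longrightarrow> k v - k u = integral {u..v} D"
  shows "has_bochner_integral lborel (\<lambda>t. (t - m) / \<sigma>\<^sup>2 * normal_density m \<sigma> t * k t)
    (\<integral>t. D t * normal_density m \<sigma> t \<partial>lborel)"
proof -
  let ?w = "normal_density m \<sigma>"
  define \<psi> where "\<psi> t = (t - m) / \<sigma>\<^sup>2 * ?w t" for t
  define \<kappa> :: "real \<Rightarrow> real \<Rightarrow> real" where
    "\<kappa> s t = (if m < s then indicator {s<..} t else - indicator {..<s} t)" for s t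
  have \<psi>_meas[measurable]: "\<psi> \<in> borel_measurable borel" unfolding \<psi>_def by measurable
  have \<kappa>_eq: "\<kappa> s t = (if m < s then (if s < t then 1 else 0) else (if t < s then -1 else 0))" for s t
    by (auto simp: \<kappa>_def indicator_def)
  have \<kappa>_meas[measurable]: "case_prod \<kappa> \<in> borel_measurable (borel \<Otimes>\<^sub>M borel)"
    unfolding \<kappa>_eq[abs_def] by measurable
  have pos: "0 \<le> \<kappa> s t * \<psi> t" for s t
    using \<sigma> by (auto simp: \<kappa>_eq \<psi>_def divide_nonpos_pos mult_nonpos_nonneg)
  have kernel: "has_bochner_integral lborel (\<lambda>t. \<kappa> s t * \<psi> t) (?w s)" for s
    using normal_score_tail[OF \<sigma>, of s m] has_bochner_integral_minus[OF normal_score_lower[OF \<sigma>, of s m]]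
    by (cases "m < s") (simp_all add: \<kappa>_def \<psi>_def)
  define \<Phi> where "\<Phi> s t = D s * (\<kappa> s t * \<psi> t)" for s t
  have \<Phi>_int: "has_bochner_integral lborel (\<Phi> s) (D s * ?w s)" for s
    unfolding \<Phi>_def using kernel by (intro has_bochner_integral_mult_right) auto
  have "integrable (lborel \<Otimes>\<^sub>M lborel) (case_prod \<Phi>)"
  proof (rule lborel_pair.Fubini_integrable)
    show "case_prod \<Phi> \<in> borel_measurable (lborel \<Otimes>\<^sub>M lborel)" unfolding \<Phi>_def by measurable
    have "norm (\<Phi> s t) = \<bar>D s\<bar> * (\<kappa> s t * \<psi> t)" for s t
      using abs_of_nonneg[OF pos[of s t]] by (simp only: \<Phi>_def real_norm_def abs_mult[of "D s"])
    then have "(\<integral>t. norm (\<Phi> s t) \<partial>lborel) = \<bar>D s\<bar> * ?w s" for s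
      using has_bochner_integral_integral_eq[OF has_bochner_integral_mult_right[OF kernel, of "\<bar>D s\<bar>" s]] by simp
    then show "integrable lborel (\<lambda>s. \<integral>t. norm (case_prod \<Phi> (s, t)) \<partial>lborel)"
      using integrable_abs[OF int] \<sigma> by (simp add: abs_mult)
    show "AE s in lborel. integrable lborel (\<lambda>t. case_prod \<Phi> (s, t))"
      using \<Phi>_int by (auto intro: integrable.intros)
  qed
  note fubini = lborel_pair.integrable_snd[OF this] lborel_pair.Fubini_integral[OF this]
  have Dint: "set_integrable lborel {u..v} D" for u v
    by (rule set_integrable_of_normal_weight[OF \<sigma> D int])
  have inner: "(\<integral>s. \<Phi> s t \<partial>lborel) = \<psi> t * (k t - k m)" for t
  proof -
    have eq: "integral {u..v} D = (\<integral>s. indicator {u<..<v} s * D s \<partial>lborel)" for u v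
    proof -
      have "set_integrable lborel {u<..<v} D" by (rule set_integrable_subset[OF Dint[of u v]]) auto
      from set_borel_integral_eq_integral(2)[OF this]
      show ?thesis by (simp add: integral_open_interval_real set_lebesgue_integral_def)
    qed
    show ?thesis
    proof (cases "m \<le> t")
      case True
      have "(\<integral>s. \<Phi> s t \<partial>lborel) = (\<integral>s. \<psi> t * (indicator {m<..<t} s * D s) \<partial>lborel)"
        using True by (intro Bochner_Integration.integral_cong) (auto simp: \<Phi>_def \<kappa>_eq indicator_def)
      then show ?thesis using k[OF True] eq[of m t] by simp
    next
      case False
      have "(\<integral>s. \<Phi> s t \<partial>lborel) = (\<integral>s. - \<psi> t * (indicator {t<..<m} s * D s) \<partial>lborel)"
      proof (rule integral_cong_AE)
        show "AE s in lborel. \<Phi> s t = - \<psi> t * (indicator {t<..<m} s * D s)"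
          using AE_lborel_singleton[of m]
          by eventually_elim (use False in \<open>auto simp: \<Phi>_def \<kappa>_eq indicator_def\<close>)
      qed (auto simp: \<Phi>_def)
      also have "\<dots> = - \<psi> t * integral {t..m} D" unfolding eq by simp
      also have "\<dots> = \<psi> t * (k t - k m)" using k[of t m] False by (simp add: algebra_simps flip: k)
      finally show ?thesis .
    qed
  qed
  have outer: "(\<integral>t. \<Phi> s t \<partial>lborel) = D s * ?w s" for s
    using has_bochner_integral_integral_eq[OF \<Phi>_int] .
  have "has_bochner_integral lborel (\<lambda>t. \<psi> t * (k t - k m)) (\<integral>t. D t * ?w t \<partial>lborel)"
    using fubini unfolding inner outer by (simp add: has_bochner_integral_iff)
  moreover have "has_bochner_integral lborel (\<lambda>t. \<psi> t * k m) (0 * k m)"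
    unfolding \<psi>_def by (intro has_bochner_integral_mult_left normal_score_integral \<sigma>)
  ultimately have "has_bochner_integral lborel (\<lambda>t. \<psi> t * (k t - k m) + \<psi> t * k m)
      ((\<integral>t. D t * ?w t \<partial>lborel) + 0 * k m)"
    by (rule has_bochner_integral_add)
  moreover have "\<psi> t * (k t - k m) + \<psi> t * k m = \<psi> t * k t" for t by (simp add: algebra_simps)
  ultimately show ?thesis by (simp add: \<psi>_def)
qed

text \<open>
  The continuous part is handled by \<open>Stein_continuous\<close> and each jump by \<open>normal_score_tail\<close>; the
  decomposition may fail at the finitely many discontinuities only.
\<close>

lemma Stein_p_abs_continuous:
  fixes h D :: "real \<Rightarrow> real"
  assumes \<sigma>: "\<sigma> > 0" and h[measurable]: "h \<in> borel_measurable borel" and ac: "p_abs_continuous h"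
    and D[measurable]: "D \<in> borel_measurable borel"
    and deriv: "\<And>t. h differentiable (at t) \<Longrightarrow> DERIV h t :> D t"
    and int: "integrable lborel (\<lambda>t. D t * normal_density m \<sigma> t)"
  shows "has_bochner_integral lborel (\<lambda>t. (t - m) / \<sigma>\<^sup>2 * normal_density m \<sigma> t * h t)
    ((\<integral>t. D t * normal_density m \<sigma> t \<partial>lborel) +
     (\<Sum>\<delta>\<in>discontinuity_set h. normal_density m \<sigma> \<delta> * jump h \<delta>))"
proof -
  let ?S = "discontinuity_set h" and ?w = "normal_density m \<sigma>"
  obtain B where B: "abs_continuous_off B h"
    using p_abs_continuous_imp_abs_continuous_off[OF ac] .
  have fin: "finite ?S" using discontinuity_set_subset(2)[OF B] .
  have neg: "negligible {t. \<not> h differentiable (at t)}"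
    by (rule abs_continuous_off_negligible_not_differentiable[OF B])
  have "set_integrable lborel {u..v} D" for u v
    by (rule set_integrable_of_normal_weight[OF \<sigma> D int])
  then have "D integrable_on {u..v}" for u v by (rule set_borel_integral_eq_integral)
  then have part: "continuous_part h v - continuous_part h u = integral {u..v} D" if "u \<le> v" for u v
    using deriv that by (intro continuous_part_integral[OF B neg]) auto
  have "has_bochner_integral lborel
      (\<lambda>t. (t - m) / \<sigma>\<^sup>2 * ?w t * continuous_part h t +
        (\<Sum>\<delta>\<in>?S. jump h \<delta> * (indicator {\<delta><..} t * ((t - m) / \<sigma>\<^sup>2 * ?w t))))
      ((\<integral>t. D t * ?w t \<partial>lborel) + (\<Sum>\<delta>\<in>?S. jump h \<delta> * ?w \<delta>))"
    by (intro has_bochner_integral_add has_bochner_integral_sum has_bochner_integral_mult_right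
        Stein_continuous[OF \<sigma> D int part] normal_score_tail[OF \<sigma>])
  then have 1: "has_bochner_integral lborel
      (\<lambda>t. (t - m) / \<sigma>\<^sup>2 * ?w t * (continuous_part h t +
        (\<Sum>\<delta>\<in>?S. jump h \<delta> * indicator {\<delta><..} t)))
      ((\<integral>t. D t * ?w t \<partial>lborel) + (\<Sum>\<delta>\<in>?S. ?w \<delta> * jump h \<delta>))"
    by (simp add: distrib_left sum_distrib_left sum_divide_distrib mult_ac)
  have "AE t in lborel. \<forall>\<delta>\<in>?S. t \<noteq> \<delta>"
    using fin by (intro AE_finite_allI AE_lborel_singleton)
  then have 2: "AE t in lborel. (t - m) / \<sigma>\<^sup>2 * ?w t * (continuous_part h t +
        (\<Sum>\<delta>\<in>?S. jump h \<delta> * indicator {\<delta><..} t)) = (t - m) / \<sigma>\<^sup>2 * ?w t * h t"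
  proof eventually_elim
    case (elim t)
    then show ?case using continuous_part_eq[of t h] by auto
  qed
  show ?thesis by (rule has_bochner_integralI_AE[OF 1 _ 2]) measurable
qed

section \<open>Differentiability through rational difference quotients\<close>

definition difference_quotient :: "(real \<Rightarrow> real) \<Rightarrow> real \<Rightarrow> real \<Rightarrow> real" where
  "difference_quotient h t s = (h (t + s) - h t) / s"

text \<open>
  A countable condition, hence measurable in the base point when \<open>h\<close> is a slice of a Borel function.
\<close>

definition rational_quotients_Cauchy :: "(real \<Rightarrow> real) \<Rightarrow> real \<Rightarrow> bool" where
  "rational_quotients_Cauchy h t \<longleftrightarrow> (\<forall>k::nat. \<exists>n::nat. \<forall>(p::rat) (q::rat).
     p \<noteq> 0 \<and> \<bar>real_of_rat p\<bar> < 1 / Suc n \<and> q \<noteq> 0 \<and> \<bar>real_of_rat q\<bar> < 1 / Suc n \<longrightarrow>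
     \<bar>difference_quotient h t (of_rat p) - difference_quotient h t (of_rat q)\<bar> \<le> 1 / Suc k)"

text \<open>
  Agrees with the derivative wherever that exists, and depends measurably on the data everywhere.
\<close>

definition sequential_deriv :: "(real \<Rightarrow> real) \<Rightarrow> real \<Rightarrow> real" where
  "sequential_deriv h t = lim (\<lambda>n. difference_quotient h t (1 / Suc n))"

lemma inverse_Suc_at_0: "filterlim (\<lambda>n. 1 / real (Suc n)) (at 0) sequentially"
  unfolding filterlim_at using LIMSEQ_Suc[OF lim_inverse_n'] by auto

lemma DERIV_sequential_deriv:
  assumes "h differentiable (at t)"
  shows "DERIV h t :> sequential_deriv h t"
proof -
  obtain L where L: "DERIV h t :> L" using assms by (auto simp: real_differentiable_def)
  then have "(difference_quotient h t \<longlongrightarrow> L) (at 0)"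
    by (simp add: DERIV_def difference_quotient_def[abs_def])
  then have "(\<lambda>n. difference_quotient h t (1 / Suc n)) \<longlonglongrightarrow> L"
    by (rule filterlim_compose[OF _ inverse_Suc_at_0])
  then show ?thesis using L by (simp add: sequential_deriv_def limI)
qed

lemma differentiable_imp_rational_quotients_Cauchy:
  assumes "h differentiable (at t)"
  shows "rational_quotients_Cauchy h t"
  unfolding rational_quotients_Cauchy_def
proof (rule allI)
  fix k :: nat
  obtain L where "DERIV h t :> L" using assms by (auto simp: real_differentiable_def)
  then have "(difference_quotient h t \<longlongrightarrow> L) (at 0)"
    by (simp add: DERIV_def difference_quotient_def[abs_def])
  then have "eventually (\<lambda>s. dist (difference_quotient h t s) L < 1 / (2 * Suc k)) (at 0)"
    by (rule tendstoD) simp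
  then obtain d where d: "d > 0"
    "\<And>s. s \<noteq> 0 \<Longrightarrow> \<bar>s\<bar> < d \<Longrightarrow> \<bar>difference_quotient h t s - L\<bar> < 1 / (2 * Suc k)"
    unfolding eventually_at by (auto simp: dist_real_def)
  obtain n where n: "1 / Suc n < d" using d(1) nat_approx_posE by blast
  have "\<bar>difference_quotient h t (of_rat p) - difference_quotient h t (of_rat q)\<bar> \<le> 1 / Suc k"
    if "p \<noteq> 0 \<and> \<bar>real_of_rat p\<bar> < 1 / Suc n \<and> q \<noteq> 0 \<and> \<bar>real_of_rat q\<bar> < 1 / Suc n" for p q :: rat
  proof -
    define c where "c = 1 / real (Suc k)"
    have c: "1 / real (2 * Suc k) = c / 2" by (simp add: c_def field_simps)
    have "\<bar>difference_quotient h t (of_rat p) - L\<bar> < 1 / (2 * Suc k)"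
      "\<bar>difference_quotient h t (of_rat q) - L\<bar> < 1 / (2 * Suc k)"
      using that n d(2)[of "real_of_rat p"] d(2)[of "real_of_rat q"] by (simp_all del: of_nat_Suc)
    then have "\<bar>difference_quotient h t (of_rat p) - difference_quotient h t (of_rat q)\<bar> \<le> c"
      unfolding c by linarith
    then show ?thesis by (simp add: c_def)
  qed
  then show "\<exists>n. \<forall>p q. p \<noteq> 0 \<and> \<bar>real_of_rat p\<bar> < 1 / Suc n \<and> q \<noteq> 0 \<and> \<bar>real_of_rat q\<bar> < 1 / Suc n \<longrightarrow>
     \<bar>difference_quotient h t (of_rat p) - difference_quotient h t (of_rat q)\<bar> \<le> 1 / Suc k"
    by blast
qed

text \<open>
  In a punctured neighbourhood of \<open>t\<close> the function is continuous, even when \<open>t\<close> is a break point. So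
  is the difference quotient as a function of the increment, and its behaviour along rational
  increments decides that along all increments.
\<close>

lemma rational_quotients_Cauchy_imp_differentiable:
  assumes ac: "abs_continuous_off B h" and C: "rational_quotients_Cauchy h t"
  shows "h differentiable (at t)"
proof -
  let ?e = "difference_quotient h t"
  obtain r where r: "r > 0" "\<And>y. y \<noteq> t \<Longrightarrow> \<bar>y - t\<bar> < r \<Longrightarrow> y \<notin> B"
    using abs_continuous_off_punctured[OF ac] by blast
  have cont: "isCont ?e s" if "s \<noteq> 0" "\<bar>s\<bar> < r" for s
  proof -
    have "isCont h (t + s)"
      using that by (intro abs_continuous_off_isCont[OF ac] r(2)) auto
    then have "isCont (\<lambda>s. h (t + s)) s"
      using isCont_o2[of s "\<lambda>s. t + s" h] by simp
    then show ?thesis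
      unfolding difference_quotient_def[abs_def] using that by (intro continuous_intros) auto
  qed
  \<comment> \<open>The increments \<open>1 / n\<close> are themselves rational, so the limit \<open>L\<close> along them exists.\<close>
  define \<rho> :: "nat \<Rightarrow> rat" where "\<rho> i = 1 / of_nat (Suc i)" for i
  have \<rho>: "real_of_rat (\<rho> i) = 1 / Suc i" "\<rho> i \<noteq> 0" for i
    by (simp_all add: \<rho>_def of_rat_divide of_rat_add)
  have \<rho>_small: "\<bar>real_of_rat (\<rho> i)\<bar> < 1 / Suc n" if "i \<ge> Suc n" for i n
    unfolding \<rho> using that by (simp add: frac_less2)
  have "Cauchy (\<lambda>n. ?e (1 / Suc n))"
    unfolding Cauchy_altdef2
  proof (intro allI impI)
    fix \<epsilon> :: real assume "\<epsilon> > 0"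
    then obtain k where k: "1 / Suc k < \<epsilon>" using nat_approx_posE by blast
    obtain n where n: "\<And>(p::rat) (q::rat).
       p \<noteq> 0 \<and> \<bar>real_of_rat p\<bar> < 1 / Suc n \<and> q \<noteq> 0 \<and> \<bar>real_of_rat q\<bar> < 1 / Suc n \<Longrightarrow>
       \<bar>?e (of_rat p) - ?e (of_rat q)\<bar> \<le> 1 / Suc k"
      using C unfolding rational_quotients_Cauchy_def by metis
    have "dist (?e (1 / Suc j)) (?e (1 / Suc (Suc n))) < \<epsilon>" if "j \<ge> Suc n" for j
    proof -
      have "\<bar>?e (1 / Suc j) - ?e (1 / Suc (Suc n))\<bar> \<le> 1 / Suc k"
        using n[of "\<rho> j" "\<rho> (Suc n)"] \<rho>_small[of n j] \<rho>_small[of n "Suc n"] \<rho>(2) that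
        unfolding \<rho>(1) by blast
      then show ?thesis using k unfolding dist_real_def by linarith
    qed
    then show "\<exists>N. \<forall>j\<ge>N. dist (?e (1 / Suc j)) (?e (1 / Suc N)) < \<epsilon>" by blast
  qed
  then obtain L where L: "(\<lambda>n. ?e (1 / Suc n)) \<longlonglongrightarrow> L"
    using Cauchy_convergent_iff convergent_def by blast
  have "(?e \<longlongrightarrow> L) (at 0)"
  proof (rule tendstoI)
    fix \<epsilon> :: real assume "\<epsilon> > 0"
    then obtain k where k: "1 / Suc k < \<epsilon>" using nat_approx_posE by blast
    obtain n where n: "\<And>(p::rat) (q::rat).
       p \<noteq> 0 \<and> \<bar>real_of_rat p\<bar> < 1 / Suc n \<and> q \<noteq> 0 \<and> \<bar>real_of_rat q\<bar> < 1 / Suc n \<Longrightarrow>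
       \<bar>?e (of_rat p) - ?e (of_rat q)\<bar> \<le> 1 / Suc k"
      using C unfolding rational_quotients_Cauchy_def by metis
    have ratL: "\<bar>?e (of_rat p) - L\<bar> \<le> 1 / Suc k" if p: "p \<noteq> 0" "\<bar>real_of_rat p\<bar> < 1 / Suc n" for p
    proof (rule LIMSEQ_le_const2)
      show "(\<lambda>j. \<bar>?e (of_rat p) - ?e (1 / Suc j)\<bar>) \<longlonglongrightarrow> \<bar>?e (of_rat p) - L\<bar>"
        by (intro tendsto_intros L)
      have "\<bar>?e (of_rat p) - ?e (1 / Suc j)\<bar> \<le> 1 / Suc k" if "j \<ge> Suc n" for j
        using n[of p "\<rho> j"] \<rho>_small[of n j] \<rho>(2) p that unfolding \<rho>(1) by blast
      then show "\<exists>N. \<forall>j\<ge>N. \<bar>?e (of_rat p) - ?e (1 / Suc j)\<bar> \<le> 1 / Suc k" by blast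
    qed
    have "\<bar>?e s - L\<bar> \<le> 1 / Suc k" if s: "s \<noteq> 0" "\<bar>s\<bar> < min r (1 / Suc n)" for s
    proof (rule ccontr)
      assume "\<not> ?thesis"
      then have far: "1 / Suc k < \<bar>?e s - L\<bar>" by simp
      have "isCont (\<lambda>y. \<bar>?e y - L\<bar>) s" using cont s by (intro continuous_intros) auto
      then have "(((\<lambda>y. \<bar>?e y - L\<bar>)) \<longlongrightarrow> \<bar>?e s - L\<bar>) (nhds s)"
        by (simp add: isCont_def tendsto_nhds_iff)
      from order_tendstoD(1)[OF this far]
      obtain d where d: "d > 0" "\<And>y. dist y s < d \<Longrightarrow> 1 / Suc k < \<bar>?e y - L\<bar>"
        unfolding eventually_nhds_metric by blast
      define d' where "d' = min d (min \<bar>s\<bar> (1 / Suc n - \<bar>s\<bar>))"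
      have d': "d' > 0" "d' \<le> d" "d' \<le> \<bar>s\<bar>" "d' \<le> 1 / Suc n - \<bar>s\<bar>"
        using d(1) s by (auto simp: d'_def)
      obtain q where q: "s < real_of_rat q" "real_of_rat q < s + d'"
        using of_rat_dense[of s "s + d'"] d'(1) by auto
      have "real_of_rat q \<noteq> 0" "\<bar>real_of_rat q\<bar> < 1 / Suc n" using q d' by linarith+
      moreover have "dist (real_of_rat q) s < d" using q d' by (simp add: dist_real_def)
      ultimately show False using ratL[of q] d(2) by fastforce
    qed
    then show "eventually (\<lambda>s. dist (?e s) L < \<epsilon>) (at 0)"
      unfolding eventually_at using r(1) k
      by (intro exI[of _ "min r (1 / Suc n)"]) (force simp: dist_real_def)
  qed
  then have "DERIV h t :> L" by (simp add: DERIV_def difference_quotient_def[abs_def])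
  then show ?thesis by (auto simp: real_differentiable_def)
qed

section \<open>Integrability from iterated integrals\<close>

text \<open>
  If the negative part of \<open>f\<close> is integrable, Tonelli's theorem computes the integral of \<open>f\<close> plus its
  negative part slice by slice, and there it is the slice integral of \<open>r\<close> plus that of the negative
  part; both are integrable functions of the slice. The other case follows by changing signs.
\<close>

lemma (in pair_sigma_finite) integrable_if_iterated_integrals:
  fixes f r :: "'a \<times> 'b \<Rightarrow> real"
  assumes f[measurable]: "f \<in> borel_measurable (M1 \<Otimes>\<^sub>M M2)"
    and r: "integrable (M1 \<Otimes>\<^sub>M M2) r"
    and slices: "AE x in M1. integrable M2 (\<lambda>y. f (x, y)) \<and> (\<integral>y. f (x, y) \<partial>M2) = (\<integral>y. r (x, y) \<partial>M2)"
    and one_sided: "(\<integral>\<^sup>+z. ennreal (f z) \<partial>(M1 \<Otimes>\<^sub>M M2)) < \<infinity> \<or>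
      (\<integral>\<^sup>+z. ennreal (- f z) \<partial>(M1 \<Otimes>\<^sub>M M2)) < \<infinity>"
  shows "has_bochner_integral (M1 \<Otimes>\<^sub>M M2) f (\<integral>z. r z \<partial>(M1 \<Otimes>\<^sub>M M2))"
proof -
  have negative_part: "integrable (M1 \<Otimes>\<^sub>M M2) f"
    if f[measurable]: "f \<in> borel_measurable (M1 \<Otimes>\<^sub>M M2)" and r: "integrable (M1 \<Otimes>\<^sub>M M2) r"
      and slices: "AE x in M1. integrable M2 (\<lambda>y. f (x, y)) \<and> (\<integral>y. f (x, y) \<partial>M2) = (\<integral>y. r (x, y) \<partial>M2)"
      and fin: "(\<integral>\<^sup>+z. ennreal (- f z) \<partial>(M1 \<Otimes>\<^sub>M M2)) < \<infinity>" for f r :: "'a \<times> 'b \<Rightarrow> real"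
  proof -
    define n where "n z = max 0 (- f z)" for z
    have n_meas[measurable]: "n \<in> borel_measurable (M1 \<Otimes>\<^sub>M M2)" unfolding n_def by measurable
    have n: "integrable (M1 \<Otimes>\<^sub>M M2) n"
    proof (rule integrableI_nonneg)
      have "(\<integral>\<^sup>+z. ennreal (n z) \<partial>(M1 \<Otimes>\<^sub>M M2)) = (\<integral>\<^sup>+z. ennreal (- f z) \<partial>(M1 \<Otimes>\<^sub>M M2))"
        by (intro nn_integral_cong) (simp add: n_def ennreal_max_0)
      then show "(\<integral>\<^sup>+z. ennreal (n z) \<partial>(M1 \<Otimes>\<^sub>M M2)) < \<infinity>" using fin by simp
    qed (auto simp: n_def)
    have rn: "integrable M1 (\<lambda>x. \<integral>y. r (x, y) \<partial>M2)" "integrable M1 (\<lambda>x. \<integral>y. n (x, y) \<partial>M2)"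
      using r n by (auto intro: integrable_fst')
    have "integrable (M1 \<Otimes>\<^sub>M M2) (\<lambda>z. f z + n z)"
    proof (rule integrableI_nonneg)
      show "AE z in M1 \<Otimes>\<^sub>M M2. 0 \<le> f z + n z" by (auto simp: n_def)
      have "(\<integral>\<^sup>+z. ennreal (f z + n z) \<partial>(M1 \<Otimes>\<^sub>M M2)) =
          (\<integral>\<^sup>+x. \<integral>\<^sup>+y. ennreal (f (x, y) + n (x, y)) \<partial>M2 \<partial>M1)"
        by (subst M2.nn_integral_fst[symmetric]) auto
      also have "\<dots> = (\<integral>\<^sup>+x. ennreal ((\<integral>y. r (x, y) \<partial>M2) + (\<integral>y. n (x, y) \<partial>M2)) \<partial>M1)"
      proof (rule nn_integral_cong_AE)
        show "AE x in M1. (\<integral>\<^sup>+y. ennreal (f (x, y) + n (x, y)) \<partial>M2) =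
            ennreal ((\<integral>y. r (x, y) \<partial>M2) + (\<integral>y. n (x, y) \<partial>M2))"
          using slices AE_integrable_fst'[OF n]
        proof eventually_elim
          case (elim x)
          then have "(\<integral>\<^sup>+y. ennreal (f (x, y) + n (x, y)) \<partial>M2) =
              ennreal (\<integral>y. f (x, y) + n (x, y) \<partial>M2)"
            by (intro nn_integral_eq_integral) (auto simp: n_def)
          then show ?case using elim by simp
        qed
      qed
      also have "\<dots> \<le> (\<integral>\<^sup>+x. ennreal (norm ((\<integral>y. r (x, y) \<partial>M2) + (\<integral>y. n (x, y) \<partial>M2))) \<partial>M1)"
        by (intro nn_integral_mono ennreal_leI) simp
      also have "\<dots> < \<infinity>"
        using Bochner_Integration.integrable_add[OF rn] unfolding integrable_iff_bounded by blast
      finally show "(\<integral>\<^sup>+z. ennreal (f z + n z) \<partial>(M1 \<Otimes>\<^sub>M M2)) < \<infinity>" .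
    qed measurable
    from Bochner_Integration.integrable_diff[OF this n] show ?thesis by simp
  qed
  have f_int: "integrable (M1 \<Otimes>\<^sub>M M2) f"
  proof (cases "(\<integral>\<^sup>+z. ennreal (- f z) \<partial>(M1 \<Otimes>\<^sub>M M2)) < \<infinity>")
    case True
    then show ?thesis using negative_part[OF f r slices] by blast
  next
    case False
    have "integrable (M1 \<Otimes>\<^sub>M M2) (\<lambda>z. - f z)"
    proof (rule negative_part[where r = "\<lambda>z. - r z"])
      show "AE x in M1. integrable M2 (\<lambda>y. - f (x, y)) \<and> (\<integral>y. - f (x, y) \<partial>M2) = (\<integral>y. - r (x, y) \<partial>M2)"
        using slices by eventually_elim auto
    qed (use r False one_sided in auto)
    then show ?thesis by simp
  qed
  have "(\<integral>z. f z \<partial>(M1 \<Otimes>\<^sub>M M2)) = (\<integral>x. \<integral>y. f (x, y) \<partial>M2 \<partial>M1)"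
    using integral_fst'[OF f_int] by simp
  also have "\<dots> = (\<integral>x. \<integral>y. r (x, y) \<partial>M2 \<partial>M1)"
    using f_int r slices by (intro integral_cong_AE) (auto dest: integrable_fst')
  also have "\<dots> = (\<integral>z. r z \<partial>(M1 \<Otimes>\<^sub>M M2))" using integral_fst'[OF r] by simp
  finally show ?thesis using f_int by (simp add: has_bochner_integral_iff)
qed

section \<open>Splitting one coordinate off the normal law\<close>

text \<open>
  The inverse of \<open>x \<mapsto> (others i x, x $ i)\<close>, written for pairs so that it can transport measures.
\<close>

definition insert_coord :: "'n \<Rightarrow> ('n \<Rightarrow> real) \<times> real \<Rightarrow> real ^ 'n" where
  "insert_coord i z = (\<chi> j. if j = i then snd z else fst z j)"

abbreviation others_lborel :: "'n \<Rightarrow> ('n \<Rightarrow> real) measure" where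
  "others_lborel i \<equiv> \<Pi>\<^sub>M j\<in>UNIV - {i}. lborel"

lemma slice_insert_coord: "slice g i y t = g (insert_coord i (y, t))"
  by (simp add: slice_def insert_coord_def cong: if_cong)

lemma others_insert_coord:
  "y \<in> space (others_lborel i) \<Longrightarrow> others i (insert_coord i (y, t)) = y"
  by (auto simp: insert_coord_def others_def space_PiM fun_eq_iff PiE_def extensional_def)

lemma insert_coord_nth: "insert_coord i (y, t) $ i = t"
  by (simp add: insert_coord_def)

lemma borel_measurable_vecI:
  fixes f :: "'a \<Rightarrow> real ^ 'n"
  assumes "\<And>j. (\<lambda>x. f x $ j) \<in> borel_measurable M"
  shows "f \<in> borel_measurable M"
  unfolding borel_measurable_euclidean_space[of f]
  using assms by (auto simp: Basis_vec_def inner_axis)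

lemma measurable_insert_coord [measurable]:
  "insert_coord i \<in> borel_measurable (others_lborel i \<Otimes>\<^sub>M lborel)"
proof (rule borel_measurable_vecI)
  show "(\<lambda>z. insert_coord i z $ j) \<in> borel_measurable (others_lborel i \<Otimes>\<^sub>M lborel)" for j
    by (cases "j = i") (auto simp: insert_coord_def)
qed

lemma measurable_others [measurable]: "others i \<in> measurable borel (others_lborel i)"
  unfolding others_def by (rule measurable_restrict) simp

text \<open>
  Both measures give a box the product of its side lengths.
\<close>

lemma lborel_eq_distr_insert_coord:
  fixes i :: "'n :: finite"
  shows "(lborel :: (real ^ 'n) measure) = distr (others_lborel i \<Otimes>\<^sub>M lborel) borel (insert_coord i)"
proof (rule lborel_eqI)
  interpret P: product_sigma_finite "\<lambda>_::'n. lborel :: real measure" ..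
  fix l u :: "real ^ 'n" assume le: "\<And>b. b \<in> Basis \<Longrightarrow> l \<bullet> b \<le> u \<bullet> b"
  have lu: "l $ j \<le> u $ j" for j
    using le[of "axis j 1"] by (simp add: inner_axis axis_in_Basis_iff)
  have "insert_coord i -` box l u \<inter> space (others_lborel i \<Otimes>\<^sub>M lborel) =
      (\<Pi>\<^sub>E j\<in>UNIV - {i}. {l $ j<..<u $ j}) \<times> {l $ i<..<u $ i}"
  proof (intro set_eqI)
    fix z :: "('n \<Rightarrow> real) \<times> real"
    obtain y t where z: "z = (y, t)" by (cases z)
    have "insert_coord i (y, t) \<in> box l u \<longleftrightarrow>
        (\<forall>j. l $ j < (if j = i then t else y j) \<and> (if j = i then t else y j) < u $ j)"
      by (simp add: mem_box_cart insert_coord_def cong: if_cong)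
    also have "\<dots> \<longleftrightarrow> (\<forall>j\<in>UNIV - {i}. l $ j < y j \<and> y j < u $ j) \<and> l $ i < t \<and> t < u $ i"
    proof -
      have "(\<forall>j. R j) \<longleftrightarrow> (\<forall>j\<in>UNIV - {i}. R j) \<and> R i" for R :: "'n \<Rightarrow> bool" by fast
      from this[of "\<lambda>j. l $ j < (if j = i then t else y j) \<and> (if j = i then t else y j) < u $ j"]
      show ?thesis by simp
    qed
    finally show "z \<in> insert_coord i -` box l u \<inter> space (others_lborel i \<Otimes>\<^sub>M lborel) \<longleftrightarrow>
        z \<in> (\<Pi>\<^sub>E j\<in>UNIV - {i}. {l $ j<..<u $ j}) \<times> {l $ i<..<u $ i}"
      unfolding z space_pair_measure space_PiM vimage_def by (simp add: PiE_iff Ball_def) blast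
  qed
  then have "emeasure (distr (others_lborel i \<Otimes>\<^sub>M lborel) borel (insert_coord i)) (box l u) =
      emeasure (others_lborel i \<Otimes>\<^sub>M lborel)
        ((\<Pi>\<^sub>E j\<in>UNIV - {i}. {l $ j<..<u $ j}) \<times> {l $ i<..<u $ i})"
    by (simp add: emeasure_distr)
  also have "\<dots> = emeasure (others_lborel i) (\<Pi>\<^sub>E j\<in>UNIV - {i}. {l $ j<..<u $ j}) *
      emeasure lborel {l $ i<..<u $ i}"
    by (intro lborel.emeasure_pair_measure_Times sets_PiM_I_finite) auto
  also have "emeasure (others_lborel i) (\<Pi>\<^sub>E j\<in>UNIV - {i}. {l $ j<..<u $ j}) =
      (\<Prod>j\<in>UNIV - {i}. emeasure lborel {l $ j<..<u $ j})"
    by (intro P.emeasure_PiM) auto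
  also have "\<dots> = ennreal (\<Prod>j\<in>UNIV - {i}. u $ j - l $ j)"
    using lu by (simp add: prod_ennreal)
  also have "\<dots> * emeasure lborel {l $ i<..<u $ i} = ennreal ((\<Prod>j\<in>UNIV - {i}. u $ j - l $ j) * (u $ i - l $ i))"
    using lu by (simp add: ennreal_mult'' prod_nonneg)
  also have "(\<Prod>j\<in>UNIV - {i}. u $ j - l $ j) * (u $ i - l $ i) = (\<Prod>j\<in>UNIV. u $ j - l $ j)"
    by (subst prod.remove[of UNIV i]) auto
  also have "\<dots> = (\<Prod>b\<in>Basis. (u - l) \<bullet> b)"
  proof -
    have B: "(Basis :: (real ^ 'n) set) = (\<lambda>j. axis j 1) ` UNIV" by (auto simp: Basis_vec_def)
    have inj: "inj (\<lambda>j::'n. axis j (1::real))" by (auto simp: inj_on_def axis_eq_axis)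
    have "(\<Prod>b\<in>Basis. (u - l) \<bullet> b) = (\<Prod>j\<in>UNIV. (u - l) \<bullet> axis j 1)"
      unfolding B prod.reindex[OF inj] o_def ..
    then show ?thesis by (simp add: inner_axis)
  qed
  finally show "emeasure (distr (others_lborel i \<Otimes>\<^sub>M lborel) borel (insert_coord i)) (box l u) =
      ennreal (\<Prod>b\<in>Basis. (u - l) \<bullet> b)" .
qed simp

lemma isotropic_normal_density_prod:
  fixes \<mu> x :: "real ^ 'n"
  shows "isotropic_normal_density \<mu> \<sigma> x = (\<Prod>j\<in>UNIV. normal_density (\<mu> $ j) \<sigma> (x $ j))"
proof -
  have "(norm (x - \<mu>))\<^sup>2 = (\<Sum>j\<in>UNIV. (x $ j - \<mu> $ j)\<^sup>2)"
    by (simp only: power2_norm_eq_inner inner_vec_def) (simp add: power2_eq_square)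
  then have "exp (- (norm (x - \<mu>))\<^sup>2 / (2 * \<sigma>\<^sup>2)) = (\<Prod>j\<in>UNIV. exp (- (x $ j - \<mu> $ j)\<^sup>2 / (2 * \<sigma>\<^sup>2)))"
    by (simp add: exp_sum[symmetric] sum_divide_distrib sum_negf)
  then show ?thesis
    by (simp add: isotropic_normal_density_def normal_density_def prod_dividef prod_constant)
qed

definition others_normal :: "'n \<Rightarrow> real ^ 'n \<Rightarrow> real \<Rightarrow> ('n \<Rightarrow> real) measure" where
  "others_normal i \<mu> \<sigma> =
     density (others_lborel i) (\<lambda>y. \<Prod>j\<in>UNIV - {i}. normal_density (\<mu> $ j) \<sigma> (y j))"

abbreviation normal_measure :: "real \<Rightarrow> real \<Rightarrow> real measure" where
  "normal_measure m \<sigma> \<equiv> density lborel (normal_density m \<sigma>)"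

lemma sigma_finite_others_normal: "sigma_finite_measure (others_normal i \<mu> \<sigma>)"
proof -
  interpret P: product_sigma_finite "\<lambda>_. lborel :: real measure" ..
  interpret sigma_finite_measure "others_lborel i" by (rule P.sigma_finite) simp
  show ?thesis
    unfolding others_normal_def by (subst sigma_finite_iff_density_finite) auto
qed

lemma isotropic_normal_eq_distr:
  fixes \<mu> :: "real ^ 'n"
  assumes "\<sigma> > 0"
  shows "density lborel (isotropic_normal_density \<mu> \<sigma>) =
    distr (others_normal i \<mu> \<sigma> \<Otimes>\<^sub>M normal_measure (\<mu> $ i) \<sigma>) borel (insert_coord i)"
proof -
  interpret N: prob_space "normal_measure (\<mu> $ i) \<sigma>" using assms by (rule prob_space_normal_density)
  let ?p = "\<lambda>y. \<Prod>j\<in>UNIV - {i}. normal_density (\<mu> $ j) \<sigma> (y j)"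
  have meas: "(\<lambda>x. ennreal (isotropic_normal_density \<mu> \<sigma> x)) \<in> borel_measurable borel"
    unfolding isotropic_normal_density_prod by measurable
  have split: "ennreal (isotropic_normal_density \<mu> \<sigma> (insert_coord i (y, t))) =
      ennreal (?p y) * ennreal (normal_density (\<mu> $ i) \<sigma> t)" for y t
  proof -
    have "isotropic_normal_density \<mu> \<sigma> (insert_coord i (y, t)) = normal_density (\<mu> $ i) \<sigma> t * ?p y"
      unfolding isotropic_normal_density_prod
      by (subst prod.remove[of UNIV i]) (auto simp: insert_coord_def intro!: prod.cong)
    then show ?thesis by (simp add: ennreal_mult prod_nonneg mult.commute)
  qed
  have "density lborel (isotropic_normal_density \<mu> \<sigma>) =
      density (distr (others_lborel i \<Otimes>\<^sub>M lborel) borel (insert_coord i)) (isotropic_normal_density \<mu> \<sigma>)"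
    by (subst lborel_eq_distr_insert_coord[of i]) simp
  also have "\<dots> = distr (density (others_lborel i \<Otimes>\<^sub>M lborel)
      (\<lambda>z. isotropic_normal_density \<mu> \<sigma> (insert_coord i z))) borel (insert_coord i)"
    by (rule density_distr[OF meas]) measurable
  also have "density (others_lborel i \<Otimes>\<^sub>M lborel) (\<lambda>z. isotropic_normal_density \<mu> \<sigma> (insert_coord i z)) =
      others_normal i \<mu> \<sigma> \<Otimes>\<^sub>M normal_measure (\<mu> $ i) \<sigma>"
  proof -
    have "others_normal i \<mu> \<sigma> \<Otimes>\<^sub>M normal_measure (\<mu> $ i) \<sigma> =
        density (others_lborel i \<Otimes>\<^sub>M lborel)
          (\<lambda>(y, t). ennreal (?p y) * ennreal (normal_density (\<mu> $ i) \<sigma> t))"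
      unfolding others_normal_def
      by (rule pair_measure_density) (auto intro: lborel.sigma_finite_measure_axioms N.sigma_finite_measure_axioms)
    also have "\<dots> = density (others_lborel i \<Otimes>\<^sub>M lborel)
        (\<lambda>z. isotropic_normal_density \<mu> \<sigma> (insert_coord i z))"
      by (simp add: split[symmetric] split_beta')
    finally show ?thesis by simp
  qed
  finally show ?thesis .
qed

lemma std_normal_density_rescale:
  assumes "\<sigma> > 0"
  shows "normal_density m \<sigma> \<delta> = std_normal_density ((\<delta> - m) / \<sigma>) / \<sigma>"
  using assms by (simp add: normal_density_def real_sqrt_mult power_divide field_simps)

text \<open>
  The difference quotient of the slice through \<open>x\<close> is that of \<open>g\<close> itself in the direction of the
  \<open>i\<close>-th axis, so it is a Borel function of \<open>x\<close> for each fixed increment.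
\<close>

lemma measurable_sequential_deriv_slice:
  fixes g :: "real ^ 'n \<Rightarrow> real"
  assumes [measurable]: "g \<in> borel_measurable borel"
  shows "(\<lambda>x. sequential_deriv (slice g i (others i x)) (x $ i)) \<in> borel_measurable borel"
    and "{x. rational_quotients_Cauchy (slice g i (others i x)) (x $ i)} \<in> sets borel"
proof -
  have [measurable]: "(\<lambda>x. difference_quotient (slice g i (others i x)) (x $ i) s) \<in> borel_measurable borel" for s
  proof -
    have shift: "slice g i (others i x) (x $ i + s) = g (x + s *\<^sub>R axis i 1)" for x s
      unfolding slice_def by (rule arg_cong[of _ _ g]) (auto simp: vec_eq_iff others_def axis_def)
    have "difference_quotient (slice g i (others i x)) (x $ i) s = (g (x + s *\<^sub>R axis i 1) - g x) / s" for x
      using shift[of x s] shift[of x 0] by (simp add: difference_quotient_def)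
    then show ?thesis by simp
  qed
  show "(\<lambda>x. sequential_deriv (slice g i (others i x)) (x $ i)) \<in> borel_measurable borel"
    unfolding sequential_deriv_def by measurable
  have "Measurable.pred borel (\<lambda>x. rational_quotients_Cauchy (slice g i (others i x)) (x $ i))"
    unfolding rational_quotients_Cauchy_def by measurable
  then show "{x. rational_quotients_Cauchy (slice g i (others i x)) (x $ i)} \<in> sets borel"
    by (simp add: pred_def)
qed

section \<open>The identity in several variables\<close>

theorem lemma5:
  fixes M :: "'a measure" and X :: "'a \<Rightarrow> real ^ 'n"
    and \<mu> :: "real ^ 'n" and \<sigma> :: real
    and g :: "real ^ 'n \<Rightarrow> real" and i :: 'n
  assumes "prob_space M"
    and "\<sigma> > 0"
    and "distributed M lborel X (\<lambda>x. ennreal (isotropic_normal_density \<mu> \<sigma> x))"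
    and "g \<in> borel_measurable borel"
    and "p_almost_differentiable g"
    and "integrable M (\<lambda>\<omega>. gradient g (X \<omega>) $ i)"
    and "integrable M (\<lambda>\<omega>. jump_sum \<mu> \<sigma> g i (others i (X \<omega>)))"
    and "has_expectation M (\<lambda>\<omega>. (X \<omega> $ i - \<mu> $ i) * g (X \<omega>))"
  shows "integrable M (\<lambda>\<omega>. (X \<omega> $ i - \<mu> $ i) * g (X \<omega>)) \<and>
    1 / \<sigma>\<^sup>2 * (\<integral>\<omega>. (X \<omega> $ i - \<mu> $ i) * g (X \<omega>) \<partial>M) =
      (\<integral>\<omega>. gradient g (X \<omega>) $ i \<partial>M) +
      1 / \<sigma> * (\<integral>\<omega>. jump_sum \<mu> \<sigma> g i (others i (X \<omega>)) \<partial>M)"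
proof -
  note \<sigma> = assms(2) and g [measurable] = assms(4)
  define Y where "Y = others_normal i \<mu> \<sigma>"
  define N where "N = normal_measure (\<mu> $ i) \<sigma>"
  interpret Y: sigma_finite_measure Y unfolding Y_def by (rule sigma_finite_others_normal)
  interpret N: prob_space N unfolding N_def using \<sigma> by (rule prob_space_normal_density)
  interpret YN: pair_sigma_finite Y N ..
  let ?T = "insert_coord i"
  have sets_Y[measurable_cong]: "sets Y = sets (others_lborel i)" and sets_N[measurable_cong]: "sets N = sets borel"
    by (simp_all add: Y_def N_def others_normal_def)
  have space_Y: "space Y = space (others_lborel i)" by (simp add: Y_def others_normal_def)
  have T[measurable]: "?T \<in> borel_measurable (Y \<Otimes>\<^sub>M N)"
    using measurable_insert_coord[of i] by (simp cong: measurable_cong_sets add: sets_Y sets_N)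
  have X[measurable]: "X \<in> borel_measurable M"
    using distributed_measurable[OF assms(3)] by simp
  have law: "distr M borel X = distr (Y \<Otimes>\<^sub>M N) borel ?T"
    using distributed_distr_eq_density[OF assms(3)] isotropic_normal_eq_distr[OF \<sigma>, of \<mu> i]
    unfolding Y_def N_def by (simp cong: distr_cong)
  have transfer: "has_bochner_integral M (\<lambda>\<omega>. f (X \<omega>)) c \<longleftrightarrow> has_bochner_integral (Y \<Otimes>\<^sub>M N) (\<lambda>z. f (?T z)) c"
    if [measurable]: "f \<in> borel_measurable borel" for f :: "real ^ 'n \<Rightarrow> real" and c
  proof -
    have "has_bochner_integral M (\<lambda>\<omega>. f (X \<omega>)) c \<longleftrightarrow> has_bochner_integral (distr M borel X) f c"
      by (simp add: has_bochner_integral_iff integrable_distr_eq integral_distr cong: conj_cong)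
    also have "\<dots> \<longleftrightarrow> has_bochner_integral (Y \<Otimes>\<^sub>M N) (\<lambda>z. f (?T z)) c"
      unfolding law by (simp add: has_bochner_integral_iff integrable_distr_eq integral_distr cong: conj_cong)
    finally show ?thesis .
  qed
  have transfer_AE: "(AE \<omega> in M. P (X \<omega>)) \<longleftrightarrow> (AE z in Y \<Otimes>\<^sub>M N. P (?T z))"
    if P: "{x. P x} \<in> sets borel" for P
  proof -
    have "(AE \<omega> in M. P (X \<omega>)) \<longleftrightarrow> (AE x in distr M borel X. P x)"
      using P by (subst AE_distr_iff) auto
    also have "\<dots> \<longleftrightarrow> (AE z in Y \<Otimes>\<^sub>M N. P (?T z))"
      unfolding law using P by (subst AE_distr_iff) auto
    finally show ?thesis .
  qed
  \<comment> \<open>The exceptional set of slices need not be measurable, so it is enlarged to a measurable null set.\<close>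
  have transfer_AE_others: "AE \<omega> in M. P (others i (X \<omega>))" if P: "AE y in Y. P y" for P
  proof -
    obtain Z where Z: "Z \<in> null_sets Y" "{y \<in> space Y. \<not> P y} \<subseteq> Z" using P unfolding eventually_ae_filter by blast
    then have ZY: "Z \<in> sets Y" by auto
    have "AE y in Y. y \<notin> Z" using Z by (auto intro: AE_not_in)
    then have "AE z in Y \<Otimes>\<^sub>M N. fst z \<notin> Z"
      using ZY by (intro YN.AE_pair_measure) auto
    moreover have "AE z in Y \<Otimes>\<^sub>M N. z \<in> space (Y \<Otimes>\<^sub>M N)" by (rule AE_space)
    ultimately have "AE z in Y \<Otimes>\<^sub>M N. others i (?T z) \<notin> Z"
      by eventually_elim (auto simp: space_pair_measure space_Y others_insert_coord)
    moreover have "{x. others i x \<notin> Z} \<in> sets borel"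
      using measurable_sets[OF measurable_others[of i], of "space Y - Z"] ZY
      by (auto simp: sets_Y space_Y vimage_def intro: measurable_space)
    ultimately have "AE \<omega> in M. others i (X \<omega>) \<notin> Z" by (subst transfer_AE)
    then show ?thesis
    proof eventually_elim
      case (elim \<omega>)
      have "others i (X \<omega>) \<in> space Y" unfolding space_Y by (rule measurable_space[OF measurable_others]) simp
      then show ?case using elim Z(2) by blast
    qed
  qed

  define G where "G x = sequential_deriv (slice g i (others i x)) (x $ i)" for x
  have G[measurable]: "G \<in> borel_measurable borel"
    unfolding G_def by (rule measurable_sequential_deriv_slice(1)[OF g])
  have good: "AE y in Y. p_abs_continuous (slice g i y)"
  proof -
    have "AE y in others_lborel i. p_abs_continuous (slice g i y)"
      using assms(5) unfolding p_almost_differentiable_def by blast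
    then show ?thesis
      unfolding Y_def others_normal_def by (subst AE_density) (auto elim: eventually_mono)
  qed
  have slice_meas[measurable]: "slice g i y \<in> borel_measurable borel" for y
    unfolding slice_def by (rule measurable_compose[OF _ g], rule borel_measurable_vecI) (simp split: if_split)
  have G_T: "G (?T (y, t)) = sequential_deriv (slice g i y) t" if "y \<in> space Y" for y t
    using that by (simp add: G_def space_Y others_insert_coord insert_coord_nth)

  \<comment> \<open>Each good slice is differentiable at almost every \<open>t\<close>; measurability turns this into a statement
    about almost every point.\<close>
  have "AE \<omega> in M. rational_quotients_Cauchy (slice g i (others i (X \<omega>))) (X \<omega> $ i)"
  proof (subst transfer_AE)
    show C: "{x. rational_quotients_Cauchy (slice g i (others i x)) (x $ i)} \<in> sets borel"
      by (rule measurable_sequential_deriv_slice(2)[OF g])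
    have "{z \<in> space (Y \<Otimes>\<^sub>M N). rational_quotients_Cauchy (slice g i (others i (?T z))) (?T z $ i)} \<in> sets (Y \<Otimes>\<^sub>M N)"
      using measurable_sets[OF T C] by (simp add: vimage_def Int_def conj_commute)
    then show "AE z in Y \<Otimes>\<^sub>M N. rational_quotients_Cauchy (slice g i (others i (?T z))) (?T z $ i)"
    proof (rule YN.AE_pair_measure)
      show "AE y in Y. AE t in N. rational_quotients_Cauchy (slice g i (others i (?T (y, t)))) (?T (y, t) $ i)"
        using good AE_space
      proof eventually_elim
        case (elim y)
        obtain B where "abs_continuous_off B (slice g i y)"
          using p_abs_continuous_imp_abs_continuous_off[OF elim(1)] .
        then have "negligible {t. \<not> slice g i y differentiable (at t)}"
          by (rule abs_continuous_off_negligible_not_differentiable)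
        then have "AE t in lebesgue. slice g i y differentiable (at t)"
          by (simp add: negligible_iff_null_sets eventually_ae_filter) blast
        then have "AE t in lborel. slice g i y differentiable (at t)" by (simp add: AE_completion_iff)
        then have "AE t in N. slice g i y differentiable (at t)"
          unfolding N_def by (subst AE_density) auto
        then show ?case
          by eventually_elim
            (use elim(2) differentiable_imp_rational_quotients_Cauchy in
              \<open>simp add: space_Y others_insert_coord insert_coord_nth\<close>)
      qed
    qed
  qed
  then have grad: "AE \<omega> in M. gradient g (X \<omega>) $ i = G (X \<omega>)"
    using transfer_AE_others[OF good]
  proof eventually_elim
    case (elim \<omega>)
    obtain B where "abs_continuous_off B (slice g i (others i (X \<omega>)))"
      using p_abs_continuous_imp_abs_continuous_off[OF elim(2)] .
    from rational_quotients_Cauchy_imp_differentiable[OF this elim(1)]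
    show ?case by (simp add: gradient_def G_def DERIV_imp_deriv[OF DERIV_sequential_deriv])
  qed
  have G_int: "integrable M (\<lambda>\<omega>. G (X \<omega>))"
    by (rule integrable_cong_AE_imp[OF assms(6) _ grad]) measurable
  have G_eq: "(\<integral>\<omega>. gradient g (X \<omega>) $ i \<partial>M) = (\<integral>\<omega>. G (X \<omega>) \<partial>M)"
    using grad assms(6) by (intro integral_cong_AE) auto
  have GT: "has_bochner_integral (Y \<Otimes>\<^sub>M N) (\<lambda>z. G (?T z)) (\<integral>\<omega>. G (X \<omega>) \<partial>M)"
    using has_bochner_integral_integrable[OF G_int] unfolding transfer[OF G] .

  define f where "f z = (snd z - \<mu> $ i) * g (?T z)" for z
  have f[measurable]: "f \<in> borel_measurable (Y \<Otimes>\<^sub>M N)" unfolding f_def by measurable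
  \<comment> \<open>The one-dimensional identity solved for the sum of the jumps, which makes it measurable in \<open>y\<close>.\<close>
  define J where "J y = \<sigma> * (1 / \<sigma>\<^sup>2 * (\<integral>t. f (y, t) \<partial>N) - (\<integral>t. G (?T (y, t)) \<partial>N))" for y
  have J[measurable]: "J \<in> borel_measurable Y" unfolding J_def by measurable
  have one_dim: "AE y in Y. integrable N (\<lambda>t. f (y, t)) \<and> integrable N (\<lambda>t. G (?T (y, t))) \<and>
      jump_sum \<mu> \<sigma> g i y = J y"
    using good AE_space YN.AE_integrable_fst'[OF integrable.intros[OF GT]]
  proof eventually_elim
    case (elim y)
    let ?h = "slice g i y" and ?w = "normal_density (\<mu> $ i) \<sigma>"
    let ?D = "sequential_deriv ?h"
    have D_eq: "G (?T (y, t)) = ?D t" for t using G_T[OF elim(2)] .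
    have D[measurable]: "?D \<in> borel_measurable borel"
    proof -
      have "(\<lambda>t. G (?T (y, t))) \<in> borel_measurable N" using elim(2) by measurable
      then show ?thesis by (simp add: D_eq sets_N cong: measurable_cong_sets)
    qed
    have D_int: "integrable lborel (\<lambda>t. ?D t * ?w t)"
      using elim(3) unfolding D_eq N_def by (simp add: integrable_density mult.commute)
    from Stein_p_abs_continuous[OF \<sigma> slice_meas elim(1) D DERIV_sequential_deriv D_int]
    have S: "has_bochner_integral lborel (\<lambda>t. (t - \<mu> $ i) / \<sigma>\<^sup>2 * ?w t * ?h t)
        ((\<integral>t. ?D t * ?w t \<partial>lborel) + (\<Sum>\<delta>\<in>discontinuity_set ?h. ?w \<delta> * jump ?h \<delta>))" by simp
    have js: "(\<Sum>\<delta>\<in>discontinuity_set ?h. ?w \<delta> * jump ?h \<delta>) = jump_sum \<mu> \<sigma> g i y / \<sigma>"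
      by (simp add: jump_sum_def jump_def std_normal_density_rescale[OF \<sigma>] sum_divide_distrib)
    have "has_bochner_integral lborel (\<lambda>t. \<sigma>\<^sup>2 * ((t - \<mu> $ i) / \<sigma>\<^sup>2 * ?w t * ?h t))
        (\<sigma>\<^sup>2 * ((\<integral>t. ?D t * ?w t \<partial>lborel) + jump_sum \<mu> \<sigma> g i y / \<sigma>))"
      using has_bochner_integral_mult_right[OF S, of "\<sigma>\<^sup>2"] by (simp add: js)
    moreover have "\<sigma>\<^sup>2 * ((t - \<mu> $ i) / \<sigma>\<^sup>2 * ?w t * ?h t) = ?w t * f (y, t)" for t
      using \<sigma> by (simp add: f_def slice_insert_coord)
    ultimately have "has_bochner_integral lborel (\<lambda>t. ?w t * f (y, t))
        (\<sigma>\<^sup>2 * ((\<integral>t. ?D t * ?w t \<partial>lborel) + jump_sum \<mu> \<sigma> g i y / \<sigma>))" by simp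
    moreover have "(\<lambda>t. f (y, t)) \<in> borel_measurable lborel"
      by (simp add: f_def flip: slice_insert_coord)
    ultimately have F: "has_bochner_integral N (\<lambda>t. f (y, t))
        (\<sigma>\<^sup>2 * ((\<integral>t. ?D t * ?w t \<partial>lborel) + jump_sum \<mu> \<sigma> g i y / \<sigma>))"
      unfolding N_def by (intro has_bochner_integral_density) auto
    have "(\<integral>t. G (?T (y, t)) \<partial>N) = (\<integral>t. ?D t * ?w t \<partial>lborel)"
      unfolding D_eq N_def by (simp add: integral_density mult.commute)
    then have "J y = jump_sum \<mu> \<sigma> g i y"
      using \<sigma> by (simp add: J_def has_bochner_integral_integral_eq[OF F] field_simps)
    then show ?case using F elim(3) by (auto intro: integrable.intros)
  qed
  have jump_eq: "AE \<omega> in M. jump_sum \<mu> \<sigma> g i (others i (X \<omega>)) = J (others i (X \<omega>))"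
    by (rule transfer_AE_others) (use one_dim in eventually_elim, blast)
  have J_others[measurable]: "(\<lambda>x. J (others i x)) \<in> borel_measurable borel"
  proof -
    have "others i \<in> measurable borel Y"
      using measurable_others[of i] unfolding measurable_cong_sets[OF refl sets_Y] .
    then show ?thesis by (rule measurable_compose[OF _ J])
  qed
  have J_int: "integrable M (\<lambda>\<omega>. J (others i (X \<omega>)))"
    by (rule integrable_cong_AE_imp[OF assms(7) _ jump_eq]) measurable
  have J_eq: "(\<integral>\<omega>. jump_sum \<mu> \<sigma> g i (others i (X \<omega>)) \<partial>M) = (\<integral>\<omega>. J (others i (X \<omega>)) \<partial>M)"
    using jump_eq assms(7) by (intro integral_cong_AE) auto
  have "has_bochner_integral (Y \<Otimes>\<^sub>M N) (\<lambda>z. J (others i (?T z))) (\<integral>\<omega>. J (others i (X \<omega>)) \<partial>M)"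
    using has_bochner_integral_integrable[OF J_int] unfolding transfer[OF J_others] .
  then have JT: "has_bochner_integral (Y \<Otimes>\<^sub>M N) (\<lambda>z. J (fst z)) (\<integral>\<omega>. J (others i (X \<omega>)) \<partial>M)"
    by (rule has_bochner_integral_cong[THEN iffD1, rotated -1])
      (auto simp: space_pair_measure space_Y others_insert_coord)

  define r where "r z = \<sigma>\<^sup>2 * (G (?T z) + 1 / \<sigma> * J (fst z))" for z
  have r: "has_bochner_integral (Y \<Otimes>\<^sub>M N) r
      (\<sigma>\<^sup>2 * ((\<integral>\<omega>. G (X \<omega>) \<partial>M) + 1 / \<sigma> * (\<integral>\<omega>. J (others i (X \<omega>)) \<partial>M)))"
    unfolding r_def by (intro has_bochner_integral_mult_right has_bochner_integral_add GT JT)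
  have F_meas[measurable]: "(\<lambda>x. (x $ i - \<mu> $ i) * g x) \<in> borel_measurable borel" by measurable
  have F_T: "(?T z $ i - \<mu> $ i) * g (?T z) = f z" for z
    by (cases z) (simp add: f_def insert_coord_nth)
  have nn: "(\<integral>\<^sup>+\<omega>. ennreal (c * ((X \<omega> $ i - \<mu> $ i) * g (X \<omega>))) \<partial>M) =
      (\<integral>\<^sup>+z. ennreal (c * f z) \<partial>(Y \<Otimes>\<^sub>M N))" for c
  proof -
    have "(\<integral>\<^sup>+\<omega>. ennreal (c * ((X \<omega> $ i - \<mu> $ i) * g (X \<omega>))) \<partial>M) =
        (\<integral>\<^sup>+x. ennreal (c * ((x $ i - \<mu> $ i) * g x)) \<partial>distr M borel X)"
      by (subst nn_integral_distr) auto
    also have "\<dots> = (\<integral>\<^sup>+z. ennreal (c * f z) \<partial>(Y \<Otimes>\<^sub>M N))"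
      unfolding law by (subst nn_integral_distr) (auto simp: F_T)
    finally show ?thesis .
  qed
  have "has_bochner_integral (Y \<Otimes>\<^sub>M N) f (\<integral>z. r z \<partial>(Y \<Otimes>\<^sub>M N))"
  proof (rule YN.integrable_if_iterated_integrals[OF f integrable.intros[OF r]])
    show "AE y in Y. integrable N (\<lambda>t. f (y, t)) \<and> (\<integral>t. f (y, t) \<partial>N) = (\<integral>t. r (y, t) \<partial>N)"
      using one_dim
    proof eventually_elim
      case (elim y)
      then have "(\<integral>t. r (y, t) \<partial>N) = \<sigma>\<^sup>2 * ((\<integral>t. G (?T (y, t)) \<partial>N) + 1 / \<sigma> * J y)"
        by (simp add: r_def N.prob_space)
      also have "\<dots> = (\<integral>t. f (y, t) \<partial>N)" using \<sigma> by (simp add: J_def power2_eq_square field_simps)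
      finally show ?case using elim by simp
    qed
    show "(\<integral>\<^sup>+z. ennreal (f z) \<partial>(Y \<Otimes>\<^sub>M N)) < \<infinity> \<or> (\<integral>\<^sup>+z. ennreal (- f z) \<partial>(Y \<Otimes>\<^sub>M N)) < \<infinity>"
      using assms(8) nn[of 1] nn[of "-1"] by (simp add: has_expectation_def)
  qed
  then have "has_bochner_integral (Y \<Otimes>\<^sub>M N) (\<lambda>z. (?T z $ i - \<mu> $ i) * g (?T z)) (\<integral>z. r z \<partial>(Y \<Otimes>\<^sub>M N))"
    unfolding F_T .
  then have "has_bochner_integral M (\<lambda>\<omega>. (X \<omega> $ i - \<mu> $ i) * g (X \<omega>))
      (\<sigma>\<^sup>2 * ((\<integral>\<omega>. G (X \<omega>) \<partial>M) + 1 / \<sigma> * (\<integral>\<omega>. J (others i (X \<omega>)) \<partial>M)))"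
    unfolding transfer[OF F_meas] has_bochner_integral_integral_eq[OF r] .
  then show ?thesis
    using \<sigma> unfolding G_eq J_eq by (simp add: has_bochner_integral_iff)
qed

end
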